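(* Let $\mathcal{A}\subseteq\mathbb{N}$ be a Diophantine set and let $p$ be a prime. For $a,f\in\mathbb{Z}$ put $b:=1+(p^2-1)(ap+1)f$. Then there exist positive integers $\alpha_1,\alpha_2$ (depending only on $\mathcal{A}$, not on $a,f,g$) and polynomials $X,Y\in\mathbb{Z}[a,f,g]$ such that, writing $\mathcal{C}:=p^{\alpha_1p}b^{\alpha_2}$, the following hold for each $a\in\mathbb{N}$: (1) If $a\in\mathcal{A}$, then for every integer $Z>0$ there exist integers $f\ge Z$ and $g\in[b,\mathcal{C})$ such that $b\in\square$, $b\in p\uparrow$ and $Y\mid\binom{pX}{X}$. (2) If there exist integers $f\neq0$ and $g\in[0,2\mathcal{C})$ such that $b\in\square$, $b\in p\uparrow$ and $Y\mid\binom{pX}{X}$, then $a\in\mathcal{A}$. (3) If $f\in\mathbb{Z}\setminus\{0\}$, $b\in\square$ and $0\le g<2\mathcal{C}$, then $p+1\mid X$, $X\ge 3b$ and $Y\ge\max\{b,p^{4p}\}$. (Here $b,\mathcal{C},X,Y$ are evaluated at the given $a,f,g$.)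
   Context: A set $\mathcal{A}\subseteq\mathbb{N}$ is Diophantine if there is a polynomial $P(t,x_1,\dots,x_n)$ with integer coefficients such that $a\in\mathcal{A}\iff\exists x_1\ge0\cdots\exists x_n\ge0\,[P(a,x_1,\dots,x_n)=0]$. $\square=\{m^2:m\in\mathbb{Z}\}$; $p\uparrow=\{p^n:n\in\mathbb{N}\}$; $[c,d)=\{m\in\mathbb{Z}:c\le m<d\}$. *)

theory Defs
  imports
    Complex_Main
    "HOL-Library.Poly_Mapping"
    "HOL-Computational_Algebra.Primes"
begin

text \<open>Integer polynomials in the indeterminates \<open>x\<^sub>0, x\<^sub>1, x\<^sub>2, \<dots>\<close>: finitely supported
  maps from monomials (finitely supported exponent vectors) to coefficients.\<close>

type_synonym int_mpoly = "(nat \<Rightarrow>\<^sub>0 nat) \<Rightarrow>\<^sub>0 int"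

definition mpoly_vars :: "int_mpoly \<Rightarrow> nat set" where
  "mpoly_vars P = (\<Union>m\<in>Poly_Mapping.keys P. Poly_Mapping.keys m)"

definition mpoly_eval :: "(nat \<Rightarrow> int) \<Rightarrow> int_mpoly \<Rightarrow> int" where
  "mpoly_eval v P = (\<Sum>m\<in>Poly_Mapping.keys P. Poly_Mapping.lookup P m *
     (\<Prod>i\<in>Poly_Mapping.keys m. v i ^ Poly_Mapping.lookup m i))"

text \<open>The parameter \<open>t\<close> is the indeterminate with index \<open>0\<close>, the unknowns are those with
  indices \<open>1, \<dots>, n\<close>; only the values \<open>x 1, \<dots>, x n\<close> of \<open>x\<close> matter.\<close>

definition diophantine :: "nat set \<Rightarrow> bool" where
  "diophantine A \<longleftrightarrow> (\<exists>(n::nat) P. mpoly_vars P \<subseteq> {0..n} \<and>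
     (\<forall>a. a \<in> A \<longleftrightarrow>
       (\<exists>x :: nat \<Rightarrow> nat. mpoly_eval (\<lambda>i. if i = 0 then int a else int (x i)) P = 0)))"

text \<open>A polynomial of \<open>\<int>[a,f,g]\<close> uses the indices \<open>0, 1, 2\<close> for \<open>a, f, g\<close> respectively.\<close>

definition poly3 :: "int_mpoly \<Rightarrow> bool" where
  "poly3 Q \<longleftrightarrow> mpoly_vars Q \<subseteq> {0, 1, 2}"

definition eval3 :: "int_mpoly \<Rightarrow> int \<Rightarrow> int \<Rightarrow> int \<Rightarrow> int" where
  "eval3 Q a f g = mpoly_eval (\<lambda>i. if i = 0 then a else if i = 1 then f else g) Q"

definition squares :: "int set" where
  "squares = {m^2 | m :: int. True}"

definition powers_of :: "nat \<Rightarrow> int set" where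
  "powers_of p = {int p ^ n | n :: nat. True}"

definition b_val :: "nat \<Rightarrow> int \<Rightarrow> int \<Rightarrow> int" where
  "b_val p a f = 1 + ((int p)^2 - 1) * (a * int p + 1) * f"

definition C_val :: "nat \<Rightarrow> nat \<Rightarrow> nat \<Rightarrow> int \<Rightarrow> int \<Rightarrow> int" where
  "C_val \<alpha>1 \<alpha>2 p a f = int p ^ (\<alpha>1 * p) * b_val p a f ^ \<alpha>2"

text \<open>\<open>y\<close> divides the binomial coefficient of \<open>px\<close> over \<open>x\<close>.  The truncation by \<open>nat\<close> is
  immaterial in the theorem, because there the divisibility only occurs together with
  hypotheses that force \<open>x > 0\<close> (its part (3)).\<close>

definition dvd_binom :: "nat \<Rightarrow> int \<Rightarrow> int \<Rightarrow> bool" where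
  "dvd_binom p y x \<longleftrightarrow> y dvd int (nat (int p * x) choose nat x)"

end

theory Submission
  imports Defs "HOL-Number_Theory.Residues" "HOL-Computational_Algebra.Polynomial"
begin

text \<open>Write \<open>B = p\<^bsup>\<beta>p\<^esup> b\<^bsup>d\<^esup>\<close>, where \<open>d\<close> bounds the degree of the polynomial \<open>P\<close> defining \<open>A\<close>, and
  let \<open>g\<close> encode the unknowns \<open>x\<^sub>j < b\<close> as digits of \<open>g\<close> in base \<open>B\<close> at the positions
  \<open>(d + 1)\<^bsup>j\<^esup>\<close>.  Expanding \<open>(1 + a B + g)\<^bsup>d\<^esup>\<close> yields all monomials in \<open>a, x\<^sub>1, \<dots>\<close> at distinct
  positions; after multiplication by a fixed polynomial in \<open>B\<close> and addition of \<open>B/p\<close> to every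
  digit, the digit at position \<open>(d + 1)\<^bsup>n\<^esup>\<close> is \<open>d! P(a, x) + B/p\<close>.  It is divisible by \<open>B/p\<close> iff
  \<open>P(a, x) = 0\<close>.  Both this divisibility and the shape of \<open>g\<close> say that certain additions in base
  \<open>p\<close> produce no carry.  They are merged into one such condition on numbers \<open>S, T < N\<close>, where
  \<open>N\<close> is a power of \<open>B\<close>, and Kummer's theorem turns it into \<open>N\<^sup>2\<close> dividing \<open>(pX choose X)\<close> for
  \<open>(p - 1) X = (N - 1) ((S + T + 1) N + T + 1)\<close>.\<close>

section \<open>Polynomial functions of three variables\<close>

definition monom_eval :: "(nat \<Rightarrow> int) \<Rightarrow> (nat \<Rightarrow>\<^sub>0 nat) \<Rightarrow> int" where
  "monom_eval v m = (\<Prod>i\<in>Poly_Mapping.keys m. v i ^ Poly_Mapping.lookup m i)"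

lemma monom_eval_superset:
  assumes "finite S" "Poly_Mapping.keys m \<subseteq> S"
  shows "monom_eval v m = (\<Prod>i\<in>S. v i ^ Poly_Mapping.lookup m i)"
  unfolding monom_eval_def
  by (rule prod.mono_neutral_left) (use assms in \<open>auto simp: in_keys_iff\<close>)

lemma monom_eval_add: "monom_eval v (m + m') = monom_eval v m * monom_eval v m'"
proof -
  let ?S = "Poly_Mapping.keys m \<union> Poly_Mapping.keys m'"
  have "monom_eval v (m + m') = (\<Prod>i\<in>?S. v i ^ Poly_Mapping.lookup (m + m') i)"
    by (rule monom_eval_superset) (auto simp: keys_add)
  also have "\<dots> = (\<Prod>i\<in>?S. v i ^ Poly_Mapping.lookup m i) * (\<Prod>i\<in>?S. v i ^ Poly_Mapping.lookup m' i)"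
    by (simp add: lookup_add power_add prod.distrib)
  also have "\<dots> = monom_eval v m * monom_eval v m'"
    by (simp add: monom_eval_superset[of ?S m] monom_eval_superset[of ?S m'])
  finally show ?thesis .
qed

lemma mpoly_eval_superset:
  assumes "finite S" "Poly_Mapping.keys P \<subseteq> S"
  shows "mpoly_eval v P = (\<Sum>m\<in>S. Poly_Mapping.lookup P m * monom_eval v m)"
  unfolding mpoly_eval_def monom_eval_def[symmetric]
  by (rule sum.mono_neutral_left) (use assms in \<open>auto simp: in_keys_iff\<close>)

lemma mpoly_eval_add: "mpoly_eval v (P + Q) = mpoly_eval v P + mpoly_eval v Q"
proof -
  let ?S = "Poly_Mapping.keys P \<union> Poly_Mapping.keys Q"
  have "mpoly_eval v (P + Q) = (\<Sum>m\<in>?S. Poly_Mapping.lookup (P + Q) m * monom_eval v m)"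
    by (rule mpoly_eval_superset) (auto simp: keys_add)
  then show ?thesis
    by (simp add: mpoly_eval_superset[of ?S P] mpoly_eval_superset[of ?S Q] lookup_add
        distrib_right sum.distrib)
qed

lemma mpoly_eval_0 [simp]: "mpoly_eval v 0 = 0"
  by (simp add: mpoly_eval_def)

lemma mpoly_eval_single: "mpoly_eval v (Poly_Mapping.single m c) = c * monom_eval v m"
  by (subst mpoly_eval_superset[of "{m}"]) auto

lemma poly_mapping_add_single_induct [case_names zero add]:
  assumes "R 0" "\<And>m c P. R P \<Longrightarrow> R (Poly_Mapping.single m c + P)"
  shows "R P"
proof (induction P rule: Poly_Mapping.update_induct)
  case (update P m c)
  have "Poly_Mapping.update m c P = Poly_Mapping.single m c + P"
    using update.hyps(1)
    by (intro poly_mapping_eqI) (auto simp: Poly_Mapping.lookup_update lookup_add lookup_single when_def in_keys_iff)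
  with assms(2)[OF update.IH] show ?case by simp
qed (rule assms)

lemma mpoly_eval_mult_single:
  "mpoly_eval v (Poly_Mapping.single m c * Q) = c * monom_eval v m * mpoly_eval v Q"
proof (induction Q rule: poly_mapping_add_single_induct)
  case (add m' c' Q)
  then show ?case
    by (simp add: mult_single mpoly_eval_single monom_eval_add mpoly_eval_add algebra_simps)
qed simp

lemma mpoly_eval_mult: "mpoly_eval v (P * Q) = mpoly_eval v P * mpoly_eval v Q"
  by (induction P rule: poly_mapping_add_single_induct)
     (simp_all add: mpoly_eval_mult_single mpoly_eval_single mpoly_eval_add distrib_right)

text \<open>Lets \<open>X\<close> and \<open>Y\<close> be written as ordinary integer functions;
  that they are polynomials then follows from closure rules rather than from explicit
  \<open>int_mpoly\<close> terms.\<close>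

definition polyfun3 :: "(int \<Rightarrow> int \<Rightarrow> int \<Rightarrow> int) \<Rightarrow> bool" where
  "polyfun3 F \<longleftrightarrow> (\<exists>Q. poly3 Q \<and> (\<forall>a f g. eval3 Q a f g = F a f g))"

lemma polyfun3_const [intro!]: "polyfun3 (\<lambda>a f g. c)"
  unfolding polyfun3_def poly3_def eval3_def mpoly_vars_def
  by (rule exI[of _ "Poly_Mapping.single 0 c"]) (auto simp: mpoly_eval_single monom_eval_def)

lemma polyfun3_var:
  fixes j :: nat
  assumes "j \<in> {0,1,2}"
  shows "polyfun3 (\<lambda>a f g. if j = 0 then a else if j = 1 then f else g)"
  unfolding polyfun3_def poly3_def eval3_def mpoly_vars_def
  by (rule exI[of _ "Poly_Mapping.single (Poly_Mapping.single j 1) 1"])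
     (use assms in \<open>auto simp: mpoly_eval_single monom_eval_def\<close>)

lemma polyfun3_a [intro!]: "polyfun3 (\<lambda>a f g. a)"
  and polyfun3_f [intro!]: "polyfun3 (\<lambda>a f g. f)"
  and polyfun3_g [intro!]: "polyfun3 (\<lambda>a f g. g)"
  using polyfun3_var[of 0] polyfun3_var[of 1] polyfun3_var[of 2] by simp_all

lemma polyfun3_add [intro!]:
  assumes "polyfun3 F" "polyfun3 G"
  shows "polyfun3 (\<lambda>a f g. F a f g + G a f g)"
proof -
  from assms obtain Q Q' where Q: "poly3 Q" "\<And>a f g. eval3 Q a f g = F a f g"
    and Q': "poly3 Q'" "\<And>a f g. eval3 Q' a f g = G a f g"
    unfolding polyfun3_def by blast
  have "mpoly_vars (Q + Q') \<subseteq> mpoly_vars Q \<union> mpoly_vars Q'"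
    using keys_add[of Q Q'] unfolding mpoly_vars_def by blast
  with Q Q' have "poly3 (Q + Q')" unfolding poly3_def by blast
  moreover have "eval3 (Q + Q') a f g = F a f g + G a f g" for a f g
    using Q Q' by (simp add: eval3_def mpoly_eval_add)
  ultimately show ?thesis unfolding polyfun3_def by blast
qed

lemma polyfun3_mult [intro!]:
  assumes "polyfun3 F" "polyfun3 G"
  shows "polyfun3 (\<lambda>a f g. F a f g * G a f g)"
proof -
  from assms obtain Q Q' where Q: "poly3 Q" "\<And>a f g. eval3 Q a f g = F a f g"
    and Q': "poly3 Q'" "\<And>a f g. eval3 Q' a f g = G a f g"
    unfolding polyfun3_def by blast
  have "mpoly_vars (Q * Q') \<subseteq> mpoly_vars Q \<union> mpoly_vars Q'"
  proof
    fix i assume "i \<in> mpoly_vars (Q * Q')"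
    then obtain m where "m \<in> Poly_Mapping.keys (Q * Q')" "i \<in> Poly_Mapping.keys m"
      unfolding mpoly_vars_def by blast
    moreover from this obtain u w where "m = u + w" "u \<in> Poly_Mapping.keys Q" "w \<in> Poly_Mapping.keys Q'"
      using keys_mult[of Q Q'] by blast
    ultimately show "i \<in> mpoly_vars Q \<union> mpoly_vars Q'"
      using keys_add[of u w] unfolding mpoly_vars_def by blast
  qed
  with Q Q' have "poly3 (Q * Q')" unfolding poly3_def by blast
  moreover have "eval3 (Q * Q') a f g = F a f g * G a f g" for a f g
    using Q Q' by (simp add: eval3_def mpoly_eval_mult)
  ultimately show ?thesis unfolding polyfun3_def by blast
qed

lemma polyfun3_diff [intro!]:
  assumes "polyfun3 F" "polyfun3 G"
  shows "polyfun3 (\<lambda>a f g. F a f g - G a f g)"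
  using polyfun3_add[OF assms(1) polyfun3_mult[OF polyfun3_const[of "-1"] assms(2)]] by simp

lemma polyfun3_power [intro!]:
  assumes "polyfun3 F"
  shows "polyfun3 (\<lambda>a f g. F a f g ^ k)"
  by (induction k) (use assms in auto)

lemma polyfun3_sum [intro!]:
  assumes "\<And>i. i \<in> I \<Longrightarrow> polyfun3 (F i)"
  shows "polyfun3 (\<lambda>a f g. \<Sum>i\<in>I. F i a f g)"
  using assms by (induction I rule: infinite_finite_induct) auto

lemma mpoly_eval_cong:
  assumes "\<And>i. i \<in> mpoly_vars P \<Longrightarrow> v i = w i"
  shows "mpoly_eval v P = mpoly_eval w P"
  unfolding mpoly_eval_def
  by (intro sum.cong prod.cong refl arg_cong2[of _ _ _ _ "(*)"] arg_cong2[of _ _ _ _ "(^)"] assms)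
     (auto simp: mpoly_vars_def)

lemma polyfun3_poly [intro!]:
  assumes "polyfun3 F"
  shows "polyfun3 (\<lambda>a f g. poly q (F a f g))"
  unfolding poly_altdef using assms by (intro polyfun3_sum polyfun3_mult polyfun3_const polyfun3_power)

lemma polyfun3_if [intro!]:
  "polyfun3 F \<Longrightarrow> polyfun3 G \<Longrightarrow> polyfun3 (\<lambda>a f g. if c then F a f g else G a f g)"
  by (cases c) auto

lemma polyfun3_b_val [intro!]: "polyfun3 (\<lambda>a f g. b_val p a f)"
  unfolding b_val_def by (intro polyfun3_add polyfun3_mult polyfun3_const polyfun3_a polyfun3_f)

section \<open>Digit sums and carries\<close>

text \<open>The guard secures termination, since for \<open>p = 1\<close> the quotient
  \<open>n div p\<close> is \<open>n\<close> again.\<close>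

fun digit_sum :: "nat \<Rightarrow> nat \<Rightarrow> nat" where
  "digit_sum p n = (if n = 0 \<or> p \<le> 1 then 0 else n mod p + digit_sum p (n div p))"

declare digit_sum.simps [simp del]

text \<open>The lowest carry, if there is one, arises without an incoming carry, so comparing the
  digits position by position detects it.\<close>

definition no_carry :: "nat \<Rightarrow> nat \<Rightarrow> nat \<Rightarrow> bool" where
  "no_carry p s t \<longleftrightarrow> (\<forall>i. s div p ^ i mod p + t div p ^ i mod p < p)"

lemma digit_sum_0 [simp]: "digit_sum p 0 = 0"
  by (simp add: digit_sum.simps)

lemma digit_sum_rec: "p \<ge> 2 \<Longrightarrow> digit_sum p n = n mod p + digit_sum p (n div p)"
  by (cases "n = 0") (simp_all add: digit_sum.simps[of p n])

lemma digit_sum_mult_add: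
  assumes "p \<ge> 2" "r < p"
  shows "digit_sum p (p * q + r) = r + digit_sum p q"
  using assms by (subst digit_sum_rec) auto

lemma no_carry_rec:
  "no_carry p s t \<longleftrightarrow> s mod p + t mod p < p \<and> no_carry p (s div p) (t div p)"
proof -
  have "(\<forall>i. Q i) \<longleftrightarrow> Q 0 \<and> (\<forall>i. Q (Suc i))" for Q :: "nat \<Rightarrow> bool"
    by (metis not0_implies_Suc)
  from this[of "\<lambda>i. s div p ^ i mod p + t div p ^ i mod p < p"] show ?thesis
    unfolding no_carry_def by (simp add: div_mult2_eq)
qed

text \<open>Adding 1 turns the trailing digits \<open>p - 1\<close> of \<open>n\<close> into zeros
  and raises the next digit by 1; the number of these trailing digits is the multiplicity of
  \<open>p\<close> in \<open>Suc n\<close>.\<close>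

lemma digit_sum_Suc:
  assumes "p \<ge> 2"
  shows "digit_sum p (Suc n) + (p - 1) * multiplicity p (Suc n) = Suc (digit_sum p n)"
proof (induction n rule: less_induct)
  case (less n)
  define q r where "q = n div p" and "r = n mod p"
  have n: "n = p * q + r" and r: "r < p" using assms by (simp_all add: q_def r_def)
  show ?case
  proof (cases "Suc r < p")
    case True
    have "Suc n mod p = Suc r" using True n by (metis add_Suc_right mod_mult_self4 mod_less mult.commute add.commute)
    then have "\<not> p dvd Suc n" by (simp add: dvd_eq_mod_eq_0)
    moreover have "digit_sum p (Suc n) = Suc r + digit_sum p q"
      using digit_sum_mult_add[OF assms True, of q] n by simp
    ultimately show ?thesis using digit_sum_mult_add[OF assms r, of q] n
      by (simp add: not_dvd_imp_multiplicity_0)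
  next
    case False
    with r have r': "r = p - 1" by simp
    have Sn: "Suc n = p * Suc q" using n r' assms by simp
    have "multiplicity p (Suc n) = Suc (multiplicity p (Suc q))"
      unfolding Sn using assms by (intro multiplicity_times_same) auto
    moreover have "digit_sum p (Suc n) = digit_sum p (Suc q)"
      using digit_sum_mult_add[OF assms, of 0 "Suc q"] assms Sn by simp
    moreover have "digit_sum p n = p - 1 + digit_sum p q"
      using digit_sum_mult_add[OF assms r, of q] n r' by simp
    moreover have "q < n"
    proof -
      have "2 * q \<le> p * q" using assms by simp
      with n r' assms show ?thesis by linarith
    qed
    note less.IH[OF this]
    ultimately show ?thesis by simp
  qed
qed

text \<open>Every carry trades \<open>p\<close> units of one digit for one unit of the next and so
  lowers the digit sum by \<open>p - 1\<close>. The induction strips the lowest digits; a carry out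
  of them becomes a \<open>Suc\<close> on the quotients and raises their digit sum by at most
  1.\<close>

lemma digit_sum_add:
  assumes "p \<ge> 2"
  shows "digit_sum p (s + t) \<le> digit_sum p s + digit_sum p t \<and>
    (digit_sum p (s + t) = digit_sum p s + digit_sum p t \<longleftrightarrow> no_carry p s t)"
proof (induction "s + t" arbitrary: s t rule: less_induct)
  case less
  show ?case
  proof (cases "s + t = 0")
    case True
    then show ?thesis using assms by (simp add: no_carry_def)
  next
    case False
    define s1 s0 t1 t0 where d: "s1 = s div p" "s0 = s mod p" "t1 = t div p" "t0 = t mod p"
    have s: "s = p * s1 + s0" "s0 < p" and t: "t = p * t1 + t0" "t0 < p"
      using assms by (simp_all add: d)
    have "2 * s1 \<le> p * s1" "2 * t1 \<le> p * t1" using assms by simp_all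
    then have "s1 + t1 < s + t" using s t False assms by linarith
    note IH = less[OF this]
    have ds: "digit_sum p s = s0 + digit_sum p s1" "digit_sum p t = t0 + digit_sum p t1"
      using digit_sum_mult_add[OF assms] s t by auto
    have nc: "no_carry p s t \<longleftrightarrow> s0 + t0 < p \<and> no_carry p s1 t1"
      unfolding d by (rule no_carry_rec)
    show ?thesis
    proof (cases "s0 + t0 < p")
      case True
      have "s + t = p * (s1 + t1) + (s0 + t0)" using s t by (simp add: algebra_simps)
      then have "digit_sum p (s + t) = s0 + t0 + digit_sum p (s1 + t1)"
        using digit_sum_mult_add[OF assms True] by simp
      then show ?thesis using IH nc ds True by auto
    next
      case False
      have "s + t = p * Suc (s1 + t1) + (s0 + t0 - p)" using s t False by (simp add: algebra_simps)
      moreover have "s0 + t0 - p < p" using s t by linarith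
      ultimately have "digit_sum p (s + t) = s0 + t0 - p + digit_sum p (Suc (s1 + t1))"
        using digit_sum_mult_add[OF assms] by presburger
      moreover have "digit_sum p (Suc (s1 + t1)) \<le> Suc (digit_sum p (s1 + t1))"
        using digit_sum_Suc[OF assms, of "s1 + t1"] by linarith
      ultimately have "digit_sum p (s + t) < digit_sum p s + digit_sum p t"
        using IH ds False assms by linarith
      then show ?thesis using nc False by simp
    qed
  qed
qed

lemma digit_sum_append:
  assumes "p \<ge> 2" "u < p ^ k"
  shows "digit_sum p (u + p ^ k * v) = digit_sum p u + digit_sum p v"
  using assms(2)
proof (induction k arbitrary: u)
  case (Suc k)
  have "u div p < p ^ k" using Suc.prems assms(1)
    by (simp add: div_less_iff_less_mult mult.commute)
  note IH = Suc.IH[OF this]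
  have "digit_sum p (u + p ^ Suc k * v)
      = (u + p ^ Suc k * v) mod p + digit_sum p ((u + p ^ Suc k * v) div p)"
    by (rule digit_sum_rec[OF assms(1)])
  also have "(u + p ^ Suc k * v) mod p = u mod p"
    by (simp add: mult.assoc)
  also have "(u + p ^ Suc k * v) div p = u div p + p ^ k * v"
    using assms(1) by (simp add: mult.assoc)
  finally show ?case using IH digit_sum_rec[OF assms(1), of u] by simp
qed simp

text \<open>Subtracting from \<open>p ^ k - 1\<close>, whose \<open>k\<close> digits are all
  \<open>p - 1\<close>, never borrows: each digit \<open>r\<close> becomes
  \<open>p - 1 - r\<close>.\<close>

lemma digit_sum_complement:
  assumes "p \<ge> 2" "u < p ^ k"
  shows "digit_sum p (p ^ k - 1 - u) + digit_sum p u = k * (p - 1)"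
  using assms(2)
proof (induction k arbitrary: u)
  case (Suc k)
  define q r where "q = u div p" and "r = u mod p"
  have u: "u = p * q + r" and r: "r < p" using assms by (simp_all add: q_def r_def)
  have q: "q < p ^ k" using Suc.prems assms(1)
    by (simp add: q_def div_less_iff_less_mult mult.commute)
  have "p ^ Suc k = p * (p ^ k - 1 - q) + p * q + p"
  proof -
    have "p ^ k = (p ^ k - 1 - q) + q + 1" using q by simp
    then have "p ^ Suc k = p * ((p ^ k - 1 - q) + q + 1)" unfolding power_Suc by (rule arg_cong)
    then show ?thesis by (simp only: distrib_left mult_1_right)
  qed
  then have "p ^ Suc k - 1 - u = p * (p ^ k - 1 - q) + (p - 1 - r)"
    using u r by linarith
  moreover have "p - 1 - r < p" using assms(1) by simp
  ultimately have "digit_sum p (p ^ Suc k - 1 - u) = p - 1 - r + digit_sum p (p ^ k - 1 - q)"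
    using digit_sum_mult_add[OF assms(1)] by simp
  moreover have "digit_sum p u = r + digit_sum p q"
    using digit_sum_mult_add[OF assms(1) r] u by simp
  ultimately show ?case using Suc.IH[OF q] r by simp
qed simp

section \<open>Legendre's formula and Kummer's theorem\<close>

text \<open>Legendre's formula, cleared of division and subtraction; \<open>digit_sum_Suc\<close> is
  the step from \<open>n\<close> to \<open>Suc n\<close>.\<close>

lemma multiplicity_fact:
  assumes "prime p"
  shows "(p - 1) * multiplicity p (fact n :: nat) + digit_sum p n = n"
proof (induction n)
  case (Suc n)
  have "multiplicity p (fact (Suc n) :: nat) = multiplicity p (Suc n) + multiplicity p (fact n :: nat)"
    unfolding fact_Suc of_nat_id using assms
    by (intro prime_elem_multiplicity_mult_distrib) auto
  then show ?case
    using Suc digit_sum_Suc[OF prime_ge_2_nat[OF assms], of n] by (simp add: algebra_simps)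
qed simp

text \<open>Legendre's formula for the three factorials yields the digit sums of \<open>x\<close>
  and \<open>(p - 1) * x\<close> minus that of \<open>p * x\<close>. Multiplication by
  \<open>p\<close> only shifts digits, so the first and the last cancel.\<close>

lemma multiplicity_binomial_mult:
  assumes "prime p"
  shows "(p - 1) * multiplicity p (p * x choose x) = digit_sum p ((p - 1) * x)"
proof -
  have p: "p \<ge> 2" using assms by (rule prime_ge_2_nat)
  have x: "x \<le> p * x" and px: "p * x - x = (p - 1) * x"
    using p by (simp_all add: diff_mult_distrib)
  have "fact x * fact ((p - 1) * x) * (p * x choose x) = (fact (p * x) :: nat)"
    using binomial_fact_lemma[OF x] px by simp
  then have "multiplicity p (fact (p * x) :: nat) =
      multiplicity p (fact x * fact ((p - 1) * x) * (p * x choose x))"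
    by simp
  also have "\<dots> = multiplicity p (fact x * fact ((p - 1) * x) :: nat) + multiplicity p (p * x choose x)"
    using assms x by (intro prime_elem_multiplicity_mult_distrib) auto
  also have "multiplicity p (fact x * fact ((p - 1) * x) :: nat)
      = multiplicity p (fact x :: nat) + multiplicity p (fact ((p - 1) * x) :: nat)"
    using assms by (intro prime_elem_multiplicity_mult_distrib) auto
  finally have "(p - 1) * multiplicity p (fact (p * x) :: nat) = (p - 1) * multiplicity p (fact x :: nat)
      + (p - 1) * multiplicity p (fact ((p - 1) * x) :: nat) + (p - 1) * multiplicity p (p * x choose x)"
    by (simp add: algebra_simps)
  moreover have "digit_sum p (p * x) = digit_sum p x"
    using digit_sum_mult_add[OF p, of 0 x] p by simp
  moreover have "x + (p - 1) * x = p * x" using x px by linarith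
  ultimately show ?thesis
    using multiplicity_fact[OF assms, of "p * x"] multiplicity_fact[OF assms, of x]
      multiplicity_fact[OF assms, of "(p - 1) * x"] by linarith
qed

text \<open>In base \<open>N\<close> the number \<open>(p - 1) x\<close> has the digits \<open>N - 1 - t\<close>, \<open>N - 1 - s\<close>, \<open>s + t\<close>
  (from the lowest), so that the multiplicity of \<open>p\<close> in the binomial coefficient is
  \<open>2 k\<close> minus the number of carries in \<open>s + t\<close>.\<close>

lemma square_dvd_binomial_iff_no_carry:
  assumes "prime p" and N: "N = p ^ k" and s: "s < N" and t: "t < N"
    and x: "(p - 1) * x = (N - 1) * ((s + t + 1) * N + t + 1)"
  shows "N ^ 2 dvd (p * x choose x) \<longleftrightarrow> no_carry p s t"
proof -
  have p: "p \<ge> 2" using assms(1) by (rule prime_ge_2_nat)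
  obtain s' where s': "N = s + s' + 1" using s less_iff_Suc_add by auto
  obtain t' where t': "N = t + t' + 1" using t less_iff_Suc_add by auto
  have "int ((N - 1) * ((s + t + 1) * N + t + 1)) = int (t' + N * (s' + N * (s + t)))"
  proof -
    have N1: "int (N - 1) = int N - 1" using s by (simp add: of_nat_diff)
    have t1: "int t' = int N - int t - 1" using t' by simp
    have s1: "int s' = int N - int s - 1" using s' by simp
    show ?thesis unfolding of_nat_mult of_nat_add of_nat_1 N1 t1 s1 by (simp add: algebra_simps)
  qed
  then have "(p - 1) * x = t' + N * (s' + N * (s + t))" unfolding x by (simp only: of_nat_eq_iff)
  then have "digit_sum p ((p - 1) * x) = digit_sum p t' + (digit_sum p s' + digit_sum p (s + t))"
    using digit_sum_append[OF p, of t' k] digit_sum_append[OF p, of s' k] s' t' N by simp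
  moreover have "s' = N - 1 - s" "t' = N - 1 - t" using s' t' by simp_all
  moreover have "digit_sum p (N - 1 - s) + digit_sum p s = k * (p - 1)"
    "digit_sum p (N - 1 - t) + digit_sum p t = k * (p - 1)"
    using digit_sum_complement[OF p] s t N by blast+
  ultimately have *: "(p - 1) * multiplicity p (p * x choose x) + digit_sum p s + digit_sum p t
      = (p - 1) * (2 * k) + digit_sum p (s + t)"
    using multiplicity_binomial_mult[OF assms(1), of x] by (simp only: mult_2 distrib_left mult.commute[of k])
  have "N ^ 2 dvd (p * x choose x) \<longleftrightarrow> 2 * k \<le> multiplicity p (p * x choose x)"
  proof -
    have "x \<le> p * x" using p by simp
    then show ?thesis using p assms(1) unfolding N power_mult[symmetric]
      by (subst power_dvd_iff_le_multiplicity) (auto simp: mult.commute)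
  qed
  also have "\<dots> \<longleftrightarrow> (p - 1) * (2 * k) \<le> (p - 1) * multiplicity p (p * x choose x)"
    using p by simp
  \<comment> \<open>Digit sums are subadditive, so the inequality can hold only as an
    equality.\<close>
  also have "\<dots> \<longleftrightarrow> digit_sum p (s + t) = digit_sum p s + digit_sum p t"
    using * digit_sum_add[OF p, of s t] by linarith
  also have "\<dots> \<longleftrightarrow> no_carry p s t" using digit_sum_add[OF p, of s t] by simp
  finally show ?thesis .
qed

section \<open>Testing digits by carry-free addition of masks\<close>

lemma no_carry_0 [simp]: "p > 0 \<Longrightarrow> no_carry p 0 t" "p > 0 \<Longrightarrow> no_carry p s 0"
  by (simp_all add: no_carry_def)

lemma no_carry_append:
  assumes "p \<ge> 2" "s0 < p ^ k" "t0 < p ^ k"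
  shows "no_carry p (s0 + p ^ k * s1) (t0 + p ^ k * t1) \<longleftrightarrow> no_carry p s0 t0 \<and> no_carry p s1 t1"
  using assms(2,3)
proof (induction k arbitrary: s0 t0)
  case 0
  then show ?case using assms(1) by simp
next
  case (Suc k)
  have "s0 div p < p ^ k" "t0 div p < p ^ k" using Suc.prems assms(1)
    by (simp_all add: div_less_iff_less_mult mult.commute)
  note IH = Suc.IH[OF this]
  have "(u + p ^ Suc k * v) mod p = u mod p" "(u + p ^ Suc k * v) div p = u div p + p ^ k * v" for u v
    using assms(1) by (simp_all add: mult.assoc)
  then show ?case
    using IH no_carry_rec[of p "s0 + p ^ Suc k * s1"] no_carry_rec[of p s0 t0] by simp
qed

text \<open>The \<open>k\<close> lowest digits of the mask are all \<open>p - 1\<close> and leave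
  room for zeros only.\<close>

lemma no_carry_power_minus_1:
  assumes "p \<ge> 2"
  shows "no_carry p s (p ^ k - 1) \<longleftrightarrow> p ^ k dvd s"
proof (induction k arbitrary: s)
  case 0
  then show ?case using assms by simp
next
  case (Suc k)
  have "p ^ Suc k = p * (p ^ k - 1) + p"
    using assms by (simp add: diff_mult_distrib2)
  then have eq: "p ^ Suc k - 1 = p * (p ^ k - 1) + (p - 1)" using assms by linarith
  have "(p ^ Suc k - 1) mod p = p - 1" "(p ^ Suc k - 1) div p = p ^ k - 1"
    unfolding eq using assms by (simp_all del: add_diff_assoc)
  then have "no_carry p s (p ^ Suc k - 1) \<longleftrightarrow> s mod p = 0 \<and> p ^ k dvd s div p"
    using no_carry_rec[of p s "p ^ Suc k - 1"] Suc.IH[of "s div p"] assms by auto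
  also have "\<dots> \<longleftrightarrow> p ^ Suc k dvd s"
  proof (cases "p dvd s")
    case True
    then obtain q where "s = p * q" by blast
    then show ?thesis using assms by simp
  next
    case False
    then show ?thesis by (auto simp: dvd_eq_mod_eq_0[of p s] dest: dvd_mult_left)
  qed
  finally show ?case .
qed

text \<open>The mask consists of \<open>r\<close> digits 0, which admit anything, below
  \<open>e - r\<close> digits \<open>p - 1\<close>, which force zeros.\<close>

lemma no_carry_power_diff:
  assumes "p \<ge> 2" "r \<le> e" "s < p ^ e"
  shows "no_carry p s (p ^ e - p ^ r) \<longleftrightarrow> s < p ^ r"
proof -
  define s1 s0 where "s1 = s div p ^ r" and "s0 = s mod p ^ r"
  have s: "s = s0 + p ^ r * s1" "s0 < p ^ r" using assms by (simp_all add: s1_def s0_def)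
  have e: "p ^ e = p ^ r * p ^ (e - r)" using assms(2) by (simp flip: power_add)
  have s1: "s1 < p ^ (e - r)"
    using assms e by (simp add: s1_def div_less_iff_less_mult mult.commute)
  have "p ^ e - p ^ r = 0 + p ^ r * (p ^ (e - r) - 1)" by (simp only: e diff_mult_distrib2 add_0 mult_1_right)
  then have "no_carry p s (p ^ e - p ^ r) \<longleftrightarrow> no_carry p s0 0 \<and> no_carry p s1 (p ^ (e - r) - 1)"
    using no_carry_append[OF assms(1), of s0 r 0 s1] s assms(1) by simp
  also have "\<dots> \<longleftrightarrow> s1 = 0"
    using assms(1) s1 no_carry_power_minus_1[OF assms(1), of s1] nat_dvd_not_less[of s1 "p ^ (e - r)"] by auto
  also have "\<dots> \<longleftrightarrow> s < p ^ r" using assms(1) by (simp add: s1_def div_eq_0_iff)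
  finally show ?thesis .
qed

lemma digits_less_power:
  fixes B :: nat
  assumes "\<And>j. j < n \<Longrightarrow> d j < B"
  shows "(\<Sum>j<n. d j * B ^ j) < B ^ n"
  using assms
proof (induction n)
  case (Suc n)
  have "(\<Sum>j<Suc n. d j * B ^ j) < B ^ n + d n * B ^ n" using Suc by simp
  also have "\<dots> = Suc (d n) * B ^ n" by simp
  also have "\<dots> \<le> B * B ^ n" using Suc.prems[of n] by (intro mult_right_mono) auto
  finally show ?case by simp
qed simp

lemma digits_expansion:
  fixes B :: nat
  assumes "B > 0" "s < B ^ n"
  shows "s = (\<Sum>j<n. (s div B ^ j mod B) * B ^ j)"
  using assms(2)
proof (induction n arbitrary: s)
  case (Suc n)
  have "s div B < B ^ n" using Suc.prems assms(1)
    by (simp add: div_less_iff_less_mult mult.commute)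
  from Suc.IH[OF this] have "s = s mod B + B * (\<Sum>j<n. (s div B div B ^ j mod B) * B ^ j)"
    by (metis mod_mult_div_eq)
  also have "B * (\<Sum>j<n. (s div B div B ^ j mod B) * B ^ j) = (\<Sum>j<n. (s div B ^ Suc j mod B) * B ^ Suc j)"
    by (simp add: sum_distrib_left div_mult2_eq mult.left_commute)
  also have "s mod B + \<dots> = (\<Sum>j<Suc n. (s div B ^ j mod B) * B ^ j)"
    by (simp only: sum.lessThan_Suc_shift power_0 div_by_1 mult_1_right)
  finally show ?case .
qed simp

lemma no_carry_digits:
  assumes "p \<ge> 2" "B = p ^ e" "\<And>j. j < n \<Longrightarrow> s j < B" "\<And>j. j < n \<Longrightarrow> t j < B"
  shows "no_carry p (\<Sum>j<n. s j * B ^ j) (\<Sum>j<n. t j * B ^ j) \<longleftrightarrow> (\<forall>j<n. no_carry p (s j) (t j))"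
  using assms(3,4)
proof (induction n)
  case 0
  then show ?case using assms(1) by simp
next
  case (Suc n)
  have B: "B ^ n = p ^ (e * n)" by (simp add: assms(2) power_mult)
  have "(\<Sum>j<n. s j * B ^ j) < p ^ (e * n)" "(\<Sum>j<n. t j * B ^ j) < p ^ (e * n)"
    using digits_less_power[of n s B] digits_less_power[of n t B] Suc.prems B by simp_all
  from no_carry_append[OF assms(1) this, of "s n" "t n"] Suc show ?case
    by (auto simp: B[symmetric] mult.commute less_Suc_eq)
qed

text \<open>Digit by digit in base \<open>B\<close>, the mask digit \<open>B - b\<close> admits
  exactly the digits below \<open>b\<close>, and \<open>B - 1\<close> admits only 0. Freedom from
  carries thus says that \<open>g\<close> is a code with small digits at the positions in
  \<open>J\<close>.\<close>

lemma no_carry_code_mask: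
  assumes "p \<ge> 2" "B = p ^ e" "b = p ^ r" "r \<le> e" "J \<subseteq> {..<n}" "g < B ^ n"
  shows "no_carry p g (\<Sum>j<n. (if j \<in> J then B - b else B - 1) * B ^ j) \<longleftrightarrow>
    (\<exists>x. (\<forall>j\<in>J. x j < b) \<and> g = (\<Sum>j\<in>J. x j * B ^ j))"
proof -
  have B: "B > 0" "b > 0" "b \<le> B" using assms by (auto intro: power_increasing)
  let ?m = "\<lambda>j. if j \<in> J then B - b else B - 1"
  have m: "?m j < B" for j using B by auto
  have nc: "no_carry p s (?m j) \<longleftrightarrow> (if j \<in> J then s < b else s = 0)" if "s < B" for s j
    using no_carry_power_diff[OF assms(1,4), of s] no_carry_power_diff[OF assms(1), of 0 e s] assms that
    by auto
  show ?thesis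
  proof
    assume *: "no_carry p g (\<Sum>j<n. ?m j * B ^ j)"
    define x where "x j = g div B ^ j mod B" for j
    have x: "x j < B" for j using B by (simp add: x_def)
    have g: "g = (\<Sum>j<n. x j * B ^ j)" using digits_expansion[OF B(1) assms(6)] by (simp add: x_def)
    have nx: "if j \<in> J then x j < b else x j = 0" if "j < n" for j
      using no_carry_digits[OF assms(1,2) x m, THEN iffD1, OF *[unfolded g]] nc[OF x, of j j] that by blast
    have "g = (\<Sum>j\<in>J. x j * B ^ j)" unfolding g
      by (rule sum.mono_neutral_right) (use assms(5) nx in \<open>auto split: if_splits\<close>)
    moreover have "\<forall>j\<in>J. x j < b" using nx assms(5) by (metis lessThan_iff subsetD)
    ultimately show "\<exists>x. (\<forall>j\<in>J. x j < b) \<and> g = (\<Sum>j\<in>J. x j * B ^ j)" by blast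
  next
    assume "\<exists>x. (\<forall>j\<in>J. x j < b) \<and> g = (\<Sum>j\<in>J. x j * B ^ j)"
    then obtain x where x: "\<And>j. j \<in> J \<Longrightarrow> x j < b" and g: "g = (\<Sum>j\<in>J. x j * B ^ j)" by blast
    let ?y = "\<lambda>j. if j \<in> J then x j else 0"
    have y: "?y j < B" for j using x[of j] B by auto
    have g: "g = (\<Sum>j<n. ?y j * B ^ j)" unfolding g
      by (rule sum.mono_neutral_cong_left) (use assms(5) in auto)
    show "no_carry p g (\<Sum>j<n. ?m j * B ^ j)"
      unfolding g no_carry_digits[OF assms(1,2) y m] nc[OF y] using x by auto
  qed
qed

text \<open>All mask digits other than the one at position \<open>i\<close> are 0, so only
  \<open>s i\<close> is tested; there \<open>B' - 1\<close> is a block of digits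
  \<open>p - 1\<close>.\<close>

lemma no_carry_digit_dvd:
  assumes "p \<ge> 2" "B = p ^ e" "B' = p ^ e'" "e' \<le> e" "i < n" "\<And>j. j < n \<Longrightarrow> s j < B"
  shows "no_carry p (\<Sum>j<n. s j * B ^ j) ((B' - 1) * B ^ i) \<longleftrightarrow> B' dvd s i"
proof -
  let ?t = "\<lambda>j. if j = i then B' - 1 else 0"
  have "0 < B'" "B' \<le> B" using assms(1-4) by (auto intro: power_increasing)
  then have t: "?t j < B" for j by auto
  have "(B' - 1) * B ^ i = (\<Sum>j<n. ?t j * B ^ j)"
    using assms(5) by (simp add: if_distrib[of "\<lambda>u. u * _"] cong: if_cong)
  then have "no_carry p (\<Sum>j<n. s j * B ^ j) ((B' - 1) * B ^ i) \<longleftrightarrow> (\<forall>j<n. no_carry p (s j) (?t j))"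
    using no_carry_digits[OF assms(1,2,6) t] by simp
  also have "\<dots> \<longleftrightarrow> no_carry p (s i) (B' - 1)" using assms(1,5) by auto
  also have "\<dots> \<longleftrightarrow> B' dvd s i" unfolding assms(3) by (rule no_carry_power_minus_1[OF assms(1)])
  finally show ?thesis .
qed

section \<open>Coding a polynomial in a digit\<close>

text \<open>For exponents with sum at most \<open>r\<close> this is the multinomial coefficient
  whose last part is the remainder of \<open>r\<close>.\<close>

fun iter_binom :: "nat \<Rightarrow> (nat \<Rightarrow> nat) \<Rightarrow> nat \<Rightarrow> nat" where
  "iter_binom r e 0 = 1"
| "iter_binom r e (Suc n) = (r choose e n) * iter_binom (r - e n) e n"

text \<open>Makes the division in \<open>weight\<close> exact.\<close>

lemma iter_binom_dvd_fact:
  assumes "(\<Sum>j<n. e j) \<le> r"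
  shows "iter_binom r e n dvd fact r"
  using assms
proof (induction n arbitrary: r)
  case (Suc n)
  have en: "e n \<le> r" using Suc.prems by simp
  have "iter_binom (r - e n) e n dvd fact (r - e n)" using Suc by simp
  then have "iter_binom r e (Suc n) dvd (r choose e n) * fact (r - e n)"
    by (simp add: mult_dvd_mono)
  also have "\<dots> dvd fact (e n) * fact (r - e n) * (r choose e n)"
    by (metis dvd_triv_right mult.assoc mult.commute)
  also have "\<dots> = fact r" using binomial_fact_lemma[OF en] by simp
  finally show ?case .
qed simp

text \<open>For \<open>x 0 = a\<close> its value at the base is \<open>1 + a B + g\<close>: the
  parameter sits at position \<open>D ^ 0 = 1\<close>, the unknowns at the higher powers of
  \<open>D\<close>. The summand 1 produces the monomials of degree below \<open>r\<close> in the
  \<open>r\<close>-th power.\<close>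

definition code_poly :: "(nat \<Rightarrow> int) \<Rightarrow> nat \<Rightarrow> nat \<Rightarrow> int poly" where
  "code_poly x D n = 1 + (\<Sum>j<n. monom (x j) (D ^ j))"

lemma degree_code_poly_power:
  assumes "r < D"
  shows "degree (code_poly x D n ^ r) < D ^ n"
proof (cases n)
  case 0
  then show ?thesis by (simp add: code_poly_def)
next
  case (Suc m)
  have "degree (\<Sum>j<n. monom (x j) (D ^ j)) \<le> D ^ m"
  proof (rule degree_sum_le)
    fix j assume "j \<in> {..<n}"
    then have "D ^ j \<le> D ^ m" using assms Suc by (intro power_increasing) auto
    then show "degree (monom (x j) (D ^ j)) \<le> D ^ m" using degree_monom_le le_trans by blast
  qed simp
  then have "degree (code_poly x D n) \<le> D ^ m"
    unfolding code_poly_def by (intro degree_add_le) auto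
  then have "degree (code_poly x D n ^ r) \<le> D ^ m * r"
    by (meson degree_power_le le_trans mult_le_mono1)
  also have "\<dots> < D ^ n" using assms Suc by (simp add: mult.commute)
  finally show ?thesis .
qed

text \<open>Since every exponent is smaller than \<open>D\<close>, the positions of distinct monomials do not
  interfere.\<close>

lemma coeff_code_poly_power:
  assumes "r < D" "(\<Sum>j<n. e j) \<le> r"
  shows "coeff (code_poly x D n ^ r) (\<Sum>j<n. e j * D ^ j) = int (iter_binom r e n) * (\<Prod>j<n. x j ^ e j)"
  using assms
proof (induction n arbitrary: r)
  case 0
  then show ?case by (simp add: code_poly_def)
next
  case (Suc n)
  let ?c = "code_poly x D n" and ?s = "\<Sum>j<n. e j * D ^ j"
  have en: "e n \<le> r" using Suc.prems by simp
  have s: "?s < D ^ n"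
  proof -
    have "e j < D" if "j < n" for j
      using member_le_sum[of j "{..<n}" e] that Suc.prems by auto
    then show ?thesis by (rule digits_less_power)
  qed
  have "code_poly x D (Suc n) = monom (x n) (D ^ n) + ?c"
    by (simp add: code_poly_def)
  then have "coeff (code_poly x D (Suc n) ^ r) (\<Sum>j<Suc n. e j * D ^ j)
     = (\<Sum>k\<le>r. int (r choose k) * coeff (monom (x n ^ k) (k * D ^ n) * ?c ^ (r - k)) (?s + e n * D ^ n))"
    by (simp add: binomial_ring coeff_sum monom_power of_nat_poly mult.assoc mult.commute[of _ "D ^ n"])
  \<comment> \<open>Only \<open>k = e n\<close> contributes: for smaller \<open>k\<close> the
    position lies beyond the degree of the remaining factor, for larger \<open>k\<close> it lies
    below the shift by the monomial.\<close>
  also have "\<dots> = (\<Sum>k\<le>r. if k = e n then int (r choose k) * (x n ^ k * coeff (?c ^ (r - k)) ?s) else 0)"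
  proof (rule sum.cong, simp, goal_cases)
    case (1 k)
    consider "k = e n" | "k < e n" | "k > e n" by linarith
    then show ?case
    proof cases
      case 1
      then show ?thesis by (simp add: coeff_monom_mult)
    next
      case 2
      then have "Suc k * D ^ n \<le> e n * D ^ n" by (intro mult_right_mono) auto
      then have "D ^ n \<le> ?s + e n * D ^ n - k * D ^ n" by simp
      moreover have "degree (?c ^ (r - k)) < D ^ n" using Suc.prems by (intro degree_code_poly_power) auto
      ultimately have "coeff (?c ^ (r - k)) (?s + e n * D ^ n - k * D ^ n) = 0"
        by (intro coeff_eq_0) linarith
      then show ?thesis using 2 by (simp add: coeff_monom_mult)
    next
      case 3
      then have "Suc (e n) * D ^ n \<le> k * D ^ n" by (intro mult_right_mono) auto
      then have "\<not> k * D ^ n \<le> ?s + e n * D ^ n" using s by simp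
      then show ?thesis using 3 by (simp add: coeff_monom_mult)
    qed
  qed
  also have "\<dots> = int (r choose e n) * (x n ^ e n * coeff (?c ^ (r - e n)) ?s)"
    using en by simp
  also have "coeff (?c ^ (r - e n)) ?s = int (iter_binom (r - e n) e n) * (\<Prod>j<n. x j ^ e j)"
    using Suc.prems by (intro Suc.IH) auto
  finally show ?case by (simp add: mult_ac)
qed

definition weight :: "int_mpoly \<Rightarrow> nat \<Rightarrow> nat \<Rightarrow> (nat \<Rightarrow>\<^sub>0 nat) \<Rightarrow> int" where
  "weight P d n m = int (fact d div iter_binom d (Poly_Mapping.lookup m) n) * Poly_Mapping.lookup P m"

text \<open>The factor \<open>weight\<close> cancels the multinomial coefficients of \<open>code_poly x D n ^ d\<close>.\<close>

definition coeff_poly :: "int_mpoly \<Rightarrow> nat \<Rightarrow> nat \<Rightarrow> int poly" where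
  "coeff_poly P d n = (\<Sum>m\<in>Poly_Mapping.keys P.
     monom (weight P d n m) (Suc d ^ n - (\<Sum>j<n. Poly_Mapping.lookup m j * Suc d ^ j)))"

definition bounded_mpoly :: "int_mpoly \<Rightarrow> nat \<Rightarrow> nat \<Rightarrow> bool" where
  "bounded_mpoly P d n \<longleftrightarrow> (\<forall>m\<in>Poly_Mapping.keys P.
     Poly_Mapping.keys m \<subseteq> {..<n} \<and> (\<Sum>j<n. Poly_Mapping.lookup m j) \<le> d)"

text \<open>\<open>coeff_poly\<close> puts the weight of \<open>m\<close> at the mirror image of the
  position of \<open>m\<close>, so the two positions add up to \<open>Suc d ^ n\<close>. The
  coefficient there is the sum over all monomials, and the weights turn every multinomial
  coefficient into \<open>fact d\<close>.\<close>

lemma coeff_code_mult_coeff_poly: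
  assumes "bounded_mpoly P d n"
  shows "coeff (code_poly x (Suc d) n ^ d * coeff_poly P d n) (Suc d ^ n) = fact d * mpoly_eval x P"
proof -
  let ?c = "code_poly x (Suc d) n ^ d" and ?E = "Suc d ^ n"
  let ?e = "\<lambda>m. \<Sum>j<n. Poly_Mapping.lookup m j * Suc d ^ j"
  have "coeff (?c * coeff_poly P d n) ?E
      = (\<Sum>m\<in>Poly_Mapping.keys P. coeff (monom (weight P d n m) (?E - ?e m) * ?c) ?E)"
    by (simp add: coeff_poly_def sum_distrib_left coeff_sum mult.commute)
  also have "\<dots> = (\<Sum>m\<in>Poly_Mapping.keys P. fact d * (Poly_Mapping.lookup P m * monom_eval x m))"
  proof (rule sum.cong[OF refl])
    fix m assume m: "m \<in> Poly_Mapping.keys P"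
    have *: "Poly_Mapping.keys m \<subseteq> {..<n}" "(\<Sum>j<n. Poly_Mapping.lookup m j) \<le> d"
      using assms m by (auto simp: bounded_mpoly_def)
    have "Poly_Mapping.lookup m j < Suc d" if "j < n" for j
      using member_le_sum[of j "{..<n}" "Poly_Mapping.lookup m"] that * by auto
    then have "?e m < ?E" by (rule digits_less_power)
    then have "coeff (monom (weight P d n m) (?E - ?e m) * ?c) ?E = weight P d n m * coeff ?c (?e m)"
      by (simp add: coeff_monom_mult)
    also have "coeff ?c (?e m) = int (iter_binom d (Poly_Mapping.lookup m) n) * (\<Prod>j<n. x j ^ Poly_Mapping.lookup m j)"
      using * by (intro coeff_code_poly_power) auto
    also have "(\<Prod>j<n. x j ^ Poly_Mapping.lookup m j) = monom_eval x m"
      using * by (intro monom_eval_superset[symmetric]) auto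
    also have "weight P d n m * (int (iter_binom d (Poly_Mapping.lookup m) n) * monom_eval x m)
       = int (fact d div iter_binom d (Poly_Mapping.lookup m) n * iter_binom d (Poly_Mapping.lookup m) n)
          * (Poly_Mapping.lookup P m * monom_eval x m)"
      by (simp add: weight_def)
    also have "fact d div iter_binom d (Poly_Mapping.lookup m) n * iter_binom d (Poly_Mapping.lookup m) n = fact d"
      using iter_binom_dvd_fact[OF *(2)] by simp
    finally show "coeff (monom (weight P d n m) (?E - ?e m) * ?c) ?E
        = fact d * (Poly_Mapping.lookup P m * monom_eval x m)" by simp
  qed
  also have "\<dots> = fact d * mpoly_eval x P"
    by (simp add: mpoly_eval_superset[OF finite_keys order_refl] sum_distrib_left)
  finally show ?thesis .
qed

section \<open>Bounds on coefficients, values and degree\<close>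

definition weight_bound :: "int_mpoly \<Rightarrow> nat \<Rightarrow> nat \<Rightarrow> int" where
  "weight_bound P d n = (\<Sum>m\<in>Poly_Mapping.keys P. \<bar>weight P d n m\<bar>)"

lemma weight_bound_nonneg: "weight_bound P d n \<ge> 0"
  by (simp add: weight_bound_def sum_nonneg)

lemma coeff_power_nonneg:
  fixes q :: "int poly"
  assumes "\<And>i. coeff q i \<ge> 0"
  shows "coeff (q ^ r) i \<ge> 0"
proof (induction r arbitrary: i)
  case (Suc r)
  then show ?case using assms by (simp add: coeff_mult sum_nonneg)
qed simp

lemma coeff_le_poly_1:
  fixes q :: "int poly"
  assumes "\<And>i. coeff q i \<ge> 0"
  shows "coeff q i \<le> poly q 1"
proof (cases "i \<le> degree q")
  case True
  then show ?thesis using assms member_le_sum[of i "{..degree q}" "coeff q"]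
    by (simp add: poly_altdef)
next
  case False
  then show ?thesis using assms by (simp add: coeff_eq_0 poly_altdef sum_nonneg)
qed

text \<open>The power of \<open>code_poly\<close> has nonnegative coefficients, so each is at most
  its value at 1; every term of \<open>coeff_poly\<close> only shifts and scales it.\<close>

lemma abs_coeff_code_mult_coeff_poly:
  assumes "\<And>j. j < n \<Longrightarrow> x j \<ge> 0"
  shows "\<bar>coeff (code_poly x (Suc d) n ^ d * coeff_poly P d n) i\<bar> \<le> (1 + (\<Sum>j<n. x j)) ^ d * weight_bound P d n"
proof -
  let ?c = "code_poly x (Suc d) n ^ d"
  have "coeff (code_poly x (Suc d) n) i \<ge> 0" for i
    using assms by (auto simp: code_poly_def coeff_sum intro!: sum_nonneg add_nonneg_nonneg)
  then have c0: "coeff ?c i \<ge> 0" for i by (rule coeff_power_nonneg)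
  have p1: "poly ?c 1 = (1 + (\<Sum>j<n. x j)) ^ d"
    by (simp add: code_poly_def poly_sum poly_monom)
  have "\<bar>coeff (?c * coeff_poly P d n) i\<bar> = \<bar>\<Sum>m\<in>Poly_Mapping.keys P.
      coeff (monom (weight P d n m) (Suc d ^ n - (\<Sum>j<n. Poly_Mapping.lookup m j * Suc d ^ j)) * ?c) i\<bar>"
    by (simp add: coeff_poly_def sum_distrib_left coeff_sum mult.commute)
  also have "\<dots> \<le> (\<Sum>m\<in>Poly_Mapping.keys P. \<bar>weight P d n m\<bar> * poly ?c 1)"
  proof (rule order_trans[OF sum_abs], rule sum_mono, goal_cases)
    case (1 m)
    have "0 \<le> poly ?c 1" using c0 coeff_le_poly_1[of ?c 0] by (meson order_trans)
    then show ?case using c0 coeff_le_poly_1[OF c0]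
      by (auto simp: coeff_monom_mult abs_mult intro!: mult_left_mono)
  qed
  also have "\<dots> = (1 + (\<Sum>j<n. x j)) ^ d * weight_bound P d n"
    by (simp only: p1 weight_bound_def sum_distrib_right[symmetric] mult.commute)
  finally show ?thesis .
qed

lemma abs_poly_coeff_poly:
  assumes "B \<ge> 1"
  shows "\<bar>poly (coeff_poly P d n) B\<bar> \<le> weight_bound P d n * B ^ (Suc d ^ n)"
proof -
  have "\<bar>poly (coeff_poly P d n) B\<bar> \<le> (\<Sum>m\<in>Poly_Mapping.keys P. \<bar>weight P d n m\<bar> *
      B ^ (Suc d ^ n - (\<Sum>j<n. Poly_Mapping.lookup m j * Suc d ^ j)))"
    unfolding coeff_poly_def poly_sum poly_monom
    by (rule order_trans[OF sum_abs]) (use assms in \<open>simp add: abs_mult\<close>)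
  also have "\<dots> \<le> (\<Sum>m\<in>Poly_Mapping.keys P. \<bar>weight P d n m\<bar> * B ^ (Suc d ^ n))"
    using assms by (intro sum_mono mult_left_mono power_increasing) auto
  finally show ?thesis by (simp add: weight_bound_def sum_distrib_right)
qed

lemma degree_code_mult_coeff_poly:
  "degree (code_poly x (Suc d) n ^ d * coeff_poly P d n) \<le> 2 * Suc d ^ n"
proof -
  have "degree (coeff_poly P d n) \<le> Suc d ^ n" unfolding coeff_poly_def
    by (rule degree_sum_le) (auto intro: order_trans[OF degree_monom_le])
  moreover have "degree (code_poly x (Suc d) n ^ d) < Suc d ^ n"
    by (rule degree_code_poly_power) simp
  ultimately show ?thesis
    using degree_mult_le[of "code_poly x (Suc d) n ^ d" "coeff_poly P d n"] by linarith
qed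

section \<open>The coding polynomials\<close>

text \<open>Here \<open>b = 1 + m f\<close> with \<open>m\<close> coprime to \<open>p\<close>. By
  Euler's theorem \<open>p ^ (2 * e)\<close> is 1 modulo \<open>m\<close> for every multiple
  \<open>e\<close> of \<open>totient m\<close>, which yields \<open>f\<close>; the even exponent
  makes \<open>b\<close> a square.\<close>

lemma ex_b_val_square_power:
  fixes W :: int and a :: nat
  assumes "prime p"
  shows "\<exists>f\<ge>W. b_val p (int a) f \<in> squares \<and> b_val p (int a) f \<in> powers_of p"
proof -
  have p: "p \<ge> 2" using assms by (rule prime_ge_2_nat)
  define m where "m = (p ^ 2 - 1) * (a * p + 1)"
  \<comment> \<open>Large enough that \<open>p ^ (2 * e) > t\<close> forces
    \<open>f > W\<close>.\<close>
  define t where "t = m * nat W + 1"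
  define e where "e = totient m * t"
  have p2: "p ^ 2 \<ge> 4" using power_mono[of 2 p 2] p by simp
  have "\<not> p dvd p ^ 2 - 1"
  proof
    assume "p dvd p ^ 2 - 1"
    moreover have "p dvd p ^ 2" by simp
    ultimately have "p dvd p ^ 2 - (p ^ 2 - 1)" by (rule dvd_diff_nat[rotated])
    with p p2 show False by simp
  qed
  moreover have "\<not> p dvd a * p + 1" using p by (simp add: dvd_add_right_iff del: One_nat_def)
  ultimately have "coprime p m"
    unfolding m_def using assms by (intro prime_imp_coprime) (simp_all only: prime_dvd_mult_iff, simp)
  then have "[p ^ totient m = 1] (mod m)" by (rule euler_theorem)
  then have "[(p ^ totient m) ^ (2 * t) = 1 ^ (2 * t)] (mod m)" by (rule cong_pow)
  then have "[int (p ^ (2 * e)) = int 1] (mod int m)"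
    unfolding cong_int_iff by (simp add: e_def mult_ac flip: power_mult)
  then have "int m dvd int (p ^ (2 * e)) - 1" by (simp add: cong_iff_dvd_diff)
  then obtain f where f: "int (p ^ (2 * e)) - 1 = int m * f" by blast
  have mpos: "m > 0" using p2 by (simp add: m_def)
  have "t \<le> 2 * e" using mpos by (simp add: e_def Suc_le_eq)
  then have "t < p ^ (2 * e)"
    using p by (metis less_le_trans less_exp power_increasing power_mono le_trans one_le_numeral zero_le_numeral)
  then have "int m * f \<ge> int t" using f by linarith
  then have "int m * f > int m * int (nat W)" by (simp add: t_def)
  then have "f > int (nat W)" using mpos by simp
  then have W: "f \<ge> W" by linarith
  have "int m = ((int p)\<^sup>2 - 1) * (int a * int p + 1)"
    unfolding m_def of_nat_mult of_nat_add using p2 by (simp add: of_nat_diff)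
  then have b: "b_val p (int a) f = int p ^ (2 * e)"
    using f by (simp add: b_val_def)
  have "b_val p (int a) f = (int p ^ e) ^ 2" unfolding b by (simp add: power_mult mult.commute)
  then have "b_val p (int a) f \<in> squares" unfolding squares_def by blast
  moreover have "b_val p (int a) f \<in> powers_of p" unfolding powers_of_def b by blast
  ultimately show ?thesis using W by blast
qed

text \<open>In \<open>b = 1 + c f\<close> one has \<open>c \<ge> 3\<close> and \<open>c > a\<close>.
  A negative \<open>f\<close> would make \<open>b\<close> negative, which no square is; hence
  \<open>f \<ge> 1\<close> and \<open>b\<close> exceeds both \<open>c - 1\<close> and
  \<open>f\<close>.\<close>

lemma b_val_bounds:
  fixes a :: nat
  assumes "p \<ge> 2" "f \<noteq> 0" "b_val p (int a) f \<in> squares"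
  shows "f > 0" "b_val p (int a) f > int a" "b_val p (int a) f > f"
proof -
  define c where "c = ((int p)\<^sup>2 - 1) * (int a * int p + 1)"
  have b: "b_val p (int a) f = 1 + c * f" by (simp add: b_val_def c_def)
  have p4: "(int p)\<^sup>2 \<ge> 4" using power_mono[of 2 "int p" 2] assms(1) by simp
  moreover have "int a * int p \<ge> int a * 1" using assms(1) by (intro mult_left_mono) auto
  ultimately have c: "c \<ge> 1 * (int a + 1)" unfolding c_def by (intro mult_mono) linarith+
  have c4: "c \<ge> 3 * 1" unfolding c_def using p4 assms(1) by (intro mult_mono) auto
  have "b_val p (int a) f \<ge> 0" using assms(3) by (auto simp: squares_def)
  then have "c * f \<ge> -1" using b by linarith
  have "\<not> f \<le> -1"
  proof
    assume "f \<le> -1"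
    then have "c * f \<le> c * (-1)" using c by (intro mult_left_mono) auto
    with \<open>c * f \<ge> -1\<close> c4 show False by linarith
  qed
  then show f: "f > 0" using assms(2) by linarith
  have "c * 1 \<le> c * f" "1 * f \<le> c * f"
    using f c c4 by (auto intro!: mult_left_mono mult_right_mono simp del: mult_1 mult_1_right)
  then have "c \<le> c * f" "f \<le> c * f" by (simp_all only: mult_1 mult_1_right)
  then have "c < 1 + c * f" "f < 1 + c * f" by auto
  then show "b_val p (int a) f > int a" "b_val p (int a) f > f" unfolding b using c by (auto elim: order.strict_trans1[rotated])
qed

lemma mult_geometric_less:
  fixes B :: int
  assumes "0 \<le> c" "c < B"
  shows "c * (\<Sum>i<m. B ^ i) < B ^ m"
proof (induction m)
  case (Suc m)
  have "c * (\<Sum>i<Suc m. B ^ i) < B ^ m + c * B ^ m" using Suc by (simp add: distrib_left)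
  also have "\<dots> = (c + 1) * B ^ m" by (simp add: algebra_simps)
  also have "\<dots> \<le> B * B ^ m" using assms by (intro mult_right_mono) auto
  finally show ?case by simp
qed simp

section \<open>The code \<open>g\<close> and the numbers \<open>S\<close> and
  \<open>T\<close>\<close>

text \<open>Index 0 is the parameter, the indices in \<open>{1..<n}\<close> are the unknowns. The
  last assumption keeps all relevant coefficients below \<open>2 ^ \<beta> * b ^ d\<close>, hence
  below \<open>subbase b\<close>; stated with 2 instead of \<open>p\<close>, it allows
  \<open>\<beta>\<close> to be chosen before \<open>p\<close>.\<close>

locale coding =
  fixes P :: int_mpoly and n d \<beta> p :: nat
  assumes P: "bounded_mpoly P d n" and n: "n \<ge> 2" and d: "d \<ge> 1" and prime_p: "prime p"
    and \<beta>: "\<beta> \<ge> 1" and weight_bound: "int (n + 1) ^ d * weight_bound P d n < 2 ^ \<beta>"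
begin

text \<open>\<open>E\<close> is the position where the value of \<open>P\<close> is read off.
  \<open>H\<close> is the exponent in the bound \<open>B ^ ((E + 2) * d) * B ^ (E + 1)\<close> for
  the product in \<open>value_code\<close>. \<open>Q\<close> counts the \<open>E + 1\<close> digits
  reserved for \<open>g\<close> and the \<open>H + 2\<close> digits of
  \<open>value_code\<close>.\<close>

definition E :: nat where "E = Suc d ^ n"
definition H :: nat where "H = (E + 2) * d + E + 1"
definition Q :: nat where "Q = E + H + 3"

text \<open>\<open>N = base b ^ (2 * Q)\<close> will bound \<open>S\<close> and \<open>T\<close>.  The exponent is even so that
  \<open>N - 1\<close> is divisible by \<open>p\<^sup>2 - 1\<close> as a polynomial; this gives \<open>p + 1 dvd X\<close>.\<close>

definition base :: "int \<Rightarrow> int" where "base b = int p ^ (\<beta> * p) * b ^ d"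
definition subbase :: "int \<Rightarrow> int" where "subbase b = int p ^ (\<beta> * p - 1) * b ^ d"

text \<open>Index 0 is left out: the parameter enters through the summand \<open>a * base b\<close>
  of \<open>value_code\<close>, not through \<open>g\<close>.\<close>

definition positions :: "nat set" where "positions = (\<lambda>j. Suc d ^ j) ` {1..<n}"

definition mask :: "int \<Rightarrow> int" where
  "mask b = (\<Sum>j<Suc E. (if j \<in> positions then base b - b else base b - 1) * base b ^ j)"

text \<open>When \<open>g\<close> is a code, the coefficients of the product are below
  \<open>subbase b\<close> in absolute value but may be negative; adding \<open>subbase b\<close> to
  each turns them into digits.\<close>

definition value_code :: "int \<Rightarrow> int \<Rightarrow> int \<Rightarrow> int" where
  "value_code a b g = (1 + a * base b + g) ^ d * poly (coeff_poly P d n) (base b)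
     + subbase b * (\<Sum>i<Suc H. base b ^ i)"

text \<open>\<open>S\<close> and \<open>T\<close> are concatenations: the lowest
  \<open>Suc E\<close> digits test the shape of \<open>g\<close>, the higher ones test the digit of
  \<open>value_code\<close> at position \<open>E\<close>.\<close>

definition S :: "int \<Rightarrow> int \<Rightarrow> int \<Rightarrow> int" where
  "S a b g = g + base b ^ Suc E * value_code a b g"

definition T :: "int \<Rightarrow> int" where
  "T b = mask b + base b ^ Suc E * ((subbase b - 1) * base b ^ E)"

lemma p_ge_2: "p \<ge> 2" using prime_p by (rule prime_ge_2_nat)

lemma E_ge: "E \<ge> 4"
proof -
  have "(2::nat) ^ 2 \<le> Suc d ^ n" using n d
    by (intro order_trans[OF power_mono[of 2 "Suc d" 2] power_increasing[of 2 n]]) auto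
  then show ?thesis by (simp add: E_def)
qed

lemma exponent_pos: "\<beta> * p - 1 \<ge> \<beta>" "\<beta> * p = Suc (\<beta> * p - 1)"
proof -
  have "\<beta> * p \<ge> \<beta> * 2" using p_ge_2 by simp
  with \<beta> show "\<beta> * p - 1 \<ge> \<beta>" "\<beta> * p = Suc (\<beta> * p - 1)" by linarith+
qed

lemma base_eq: "base b = int p * subbase b"
proof -
  have "int p ^ (\<beta> * p) = int p ^ Suc (\<beta> * p - 1)" using exponent_pos(2) by (rule arg_cong)
  then show ?thesis unfolding base_def subbase_def by simp
qed

context
  fixes b :: int
  assumes b: "b \<ge> 2"
begin

lemma power_b: "b ^ d \<ge> b"
  using power_increasing[of 1 d b] d b by simp

lemma subbase_ge: "subbase b \<ge> 2 ^ \<beta> * b ^ d"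
proof -
  have "(2::int) ^ \<beta> \<le> int p ^ \<beta>" using p_ge_2 by (intro power_mono) auto
  also have "\<dots> \<le> int p ^ (\<beta> * p - 1)" using p_ge_2 exponent_pos by (intro power_increasing) auto
  finally show ?thesis unfolding subbase_def using b by (intro mult_right_mono) auto
qed

lemma subbase_ge_b: "subbase b \<ge> b"
proof -
  have "1 * b \<le> 2 ^ \<beta> * b ^ d" using power_b b by (intro mult_mono) auto
  with subbase_ge show ?thesis by linarith
qed

lemma base_ge: "base b \<ge> 2 * subbase b" "base b \<ge> 4" "base b > b"
proof -
  show "base b \<ge> 2 * subbase b" unfolding base_eq using p_ge_2 subbase_ge_b b
    by (intro mult_right_mono) auto
  then show "base b \<ge> 4" "base b > b" using subbase_ge_b b by auto
qed

lemma weight_bound_less_base: "weight_bound P d n < base b"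
proof -
  have "1 * weight_bound P d n \<le> int (n + 1) ^ d * weight_bound P d n"
    using weight_bound_nonneg by (intro mult_right_mono one_le_power) auto
  also note weight_bound
  also have "2 ^ \<beta> * 1 \<le> 2 ^ \<beta> * b ^ d" using b by (intro mult_left_mono one_le_power) auto
  then have "(2::int) ^ \<beta> \<le> base b" using subbase_ge base_ge b subbase_ge_b by linarith
  finally show ?thesis by simp
qed

text \<open>Size estimates for every \<open>g\<close> in the range, since the digits of
  \<open>value_code\<close> are known only once \<open>g\<close> is known to be a code. The product
  is at most \<open>B ^ H\<close> in absolute value, which the top summand
  \<open>subbase b * B ^ H\<close> outweighs.\<close>

lemma value_code_bounds:
  assumes a: "0 \<le> a" "a < b" and g: "0 \<le> g" "g < 2 * base b ^ E"
  shows "0 \<le> value_code a b g" "value_code a b g < base b ^ (H + 2)"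
proof -
  let ?B = "base b"
  have B: "?B \<ge> 4" "a \<le> ?B - 1" using base_ge a by auto
  let ?c = "1 + a * ?B + g"
  have c0: "?c \<ge> 0" using a g B by simp
  have "a * ?B \<le> (?B - 1) * ?B" using B by (intro mult_right_mono) auto
  then have "1 + a * ?B \<le> ?B ^ 2" using B by (simp add: algebra_simps power2_eq_square)
  also have "\<dots> \<le> ?B ^ E" using B E_ge by (intro power_increasing) auto
  finally have "?c \<le> 4 * ?B ^ E" using g by linarith
  also have "\<dots> \<le> ?B * ?B ^ E" using B by (intro mult_right_mono) auto
  also have "\<dots> \<le> ?B ^ (E + 2)" using power_increasing[of "Suc E" "E + 2" ?B] B by simp
  finally have c: "?c ^ d \<le> ?B ^ ((E + 2) * d)" using c0 by (simp only: power_mult power_mono)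
  let ?F = "?c ^ d * poly (coeff_poly P d n) ?B"
  have "\<bar>?F\<bar> \<le> ?B ^ ((E + 2) * d) * (weight_bound P d n * ?B ^ E)"
    unfolding abs_mult power_abs[symmetric] using abs_poly_coeff_poly[of ?B P d n] B c c0
    by (intro mult_mono) (auto simp: E_def power_abs)
  also have "\<dots> \<le> ?B ^ ((E + 2) * d) * (?B * ?B ^ E)"
    using weight_bound_less_base B by (intro mult_left_mono mult_right_mono) auto
  also have "\<dots> = ?B ^ H" by (simp add: H_def power_add)
  finally have F: "\<bar>?F\<bar> \<le> ?B ^ H" .
  have "subbase b * ?B ^ H \<le> subbase b * (\<Sum>i<Suc H. ?B ^ i)"
    using subbase_ge_b b B by (intro mult_left_mono) (auto intro: sum_nonneg)
  moreover have "1 * ?B ^ H \<le> subbase b * ?B ^ H"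
    using subbase_ge_b b B by (intro mult_right_mono) auto
  ultimately show "0 \<le> value_code a b g" unfolding value_code_def using F by linarith
  have "subbase b * (\<Sum>i<Suc H. ?B ^ i) < ?B ^ Suc H"
    using subbase_ge_b base_ge b by (intro mult_geometric_less) auto
  moreover have "?B ^ H \<le> ?B ^ Suc H" using B by (intro power_increasing) auto
  moreover have "?B ^ (H + 2) \<ge> 4 * ?B ^ Suc H" using B by (simp add: mult_right_mono)
  moreover have "?B ^ Suc H > 0" using B by simp
  ultimately show "value_code a b g < ?B ^ (H + 2)" unfolding value_code_def using F by linarith
qed

lemma mask_bounds: "0 \<le> mask b" "mask b < base b ^ Suc E"
proof -
  have B: "base b > b" using base_ge by auto
  show "0 \<le> mask b" unfolding mask_def using B b by (intro sum_nonneg mult_nonneg_nonneg) auto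
  have "mask b \<le> (\<Sum>j<Suc E. (base b - 1) * base b ^ j)"
    unfolding mask_def using B b by (intro sum_mono mult_right_mono) auto
  also have "\<dots> < base b ^ Suc E"
    unfolding sum_distrib_left[symmetric] using B b by (intro mult_geometric_less) auto
  finally show "mask b < base b ^ Suc E" .
qed

lemma less_power_Suc_E:
  assumes "g < 2 * base b ^ E"
  shows "g < base b ^ Suc E"
proof -
  have "2 * base b ^ E \<le> base b * base b ^ E" using base_ge by (intro mult_right_mono) auto
  with assms show ?thesis by simp
qed

lemma append_less:
  fixes u v B :: int
  assumes "u < B ^ k" "v < B ^ l" "B > 1" "k + l \<le> m"
  shows "u + B ^ k * v < B ^ m"
proof -
  have "u + B ^ k * v < B ^ k * (v + 1)" using assms by (simp add: algebra_simps)
  also have "\<dots> \<le> B ^ k * B ^ l" using assms by (intro mult_left_mono) auto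
  also have "\<dots> \<le> B ^ m" using assms by (simp flip: power_add)
  finally show ?thesis .
qed

lemma S_T_bounds:
  assumes "0 \<le> a" "a < b" "0 \<le> g" "g < 2 * base b ^ E"
  shows "0 \<le> S a b g" "S a b g < base b ^ (2 * Q)" "0 \<le> T b" "T b < base b ^ (2 * Q)"
proof -
  have B: "base b \<ge> 4" using base_ge by simp
  note K = value_code_bounds[OF assms]
  show "0 \<le> S a b g" unfolding S_def using K B assms by simp
  show "S a b g < base b ^ (2 * Q)" unfolding S_def
    by (rule append_less[OF less_power_Suc_E K(2)]) (use assms B in \<open>auto simp: Q_def\<close>)
  have s: "0 \<le> subbase b - 1" "subbase b - 1 < base b" using subbase_ge_b base_ge b by auto
  show "0 \<le> T b" unfolding T_def using mask_bounds s B by simp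
  have "(subbase b - 1) * base b ^ E < base b ^ Suc E"
    unfolding power_Suc by (rule mult_strict_right_mono[OF s(2)]) (use B in auto)
  from append_less[OF mask_bounds(2) this] show "T b < base b ^ (2 * Q)" unfolding T_def
    using B by (auto simp: Q_def H_def)
qed

end

text \<open>For a code \<open>g\<close> the digits of \<open>value_code\<close> are the numbers
  \<open>coeff F i + subbase b\<close>. The one at \<open>E\<close> is \<open>fact d\<close> times
  the value of \<open>P\<close>, plus \<open>subbase b\<close>; that multiple of the value is
  smaller than \<open>subbase b\<close> in size, so divisibility means that it vanishes.\<close>

lemma value_code_mask:
  assumes b: "b = int (p ^ r)" "b \<ge> 2" and x: "\<And>j. j \<in> {1..<n} \<Longrightarrow> x j < p ^ r"
    and a: "int a < b" and g: "g = (\<Sum>j\<in>{1..<n}. int (x j) * base b ^ (Suc d ^ j))"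
  shows "no_carry p (nat (value_code (int a) b g)) ((nat (subbase b) - 1) * nat (base b) ^ E) \<longleftrightarrow>
    mpoly_eval (\<lambda>i. if i = 0 then int a else int (x i)) P = 0"
proof -
  define v where "v = (\<lambda>i. if i = 0 then int a else int (x i))"
  define F where "F = code_poly v (Suc d) n ^ d * coeff_poly P d n"
  let ?B = "base b" and ?B' = "subbase b"
  have B: "?B \<ge> 2 * ?B'" "?B \<ge> 4" "?B' \<ge> b" "?B' \<ge> 2 ^ \<beta> * b ^ d"
    using base_ge[OF b(2)] subbase_ge_b[OF b(2)] subbase_ge[OF b(2)] by auto
  have v: "0 \<le> v j" "j < n \<Longrightarrow> v j \<le> b" for j
    using a x[of j] by (auto simp: v_def b(1) simp flip: of_nat_power)
  have "1 + (\<Sum>j<n. v j) \<le> b + (\<Sum>j<n. b)" using v b(2) by (intro add_mono sum_mono) auto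
  also have "\<dots> = int (n + 1) * b" by (simp add: algebra_simps)
  finally have sum_v: "1 + (\<Sum>j<n. v j) \<le> int (n + 1) * b" .
  have coeff_F: "\<bar>coeff F i\<bar> < ?B'" for i
  proof -
    have "\<bar>coeff F i\<bar> \<le> (1 + (\<Sum>j<n. v j)) ^ d * weight_bound P d n"
      unfolding F_def by (rule abs_coeff_code_mult_coeff_poly) (rule v(1))
    also have "\<dots> \<le> (int (n + 1) * b) ^ d * weight_bound P d n"
      using sum_v v(1) weight_bound_nonneg by (intro mult_right_mono power_mono) (auto simp: sum_nonneg)
    also have "\<dots> = (int (n + 1) ^ d * weight_bound P d n) * b ^ d"
      by (simp only: power_mult_distrib mult_ac)
    also have "\<dots> < 2 ^ \<beta> * b ^ d"
      using weight_bound b(2) by (intro mult_strict_right_mono) auto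
    finally show ?thesis using B by linarith
  qed
  have "{..<n} = insert 0 {1..<n}" using n by auto
  then have "poly (code_poly v (Suc d) n) ?B = 1 + int a * ?B + g"
    unfolding code_poly_def g by (simp add: poly_sum poly_monom v_def)
  then have "value_code (int a) b g = poly F ?B + ?B' * (\<Sum>i<Suc H. ?B ^ i)"
    by (simp add: value_code_def F_def)
  also have "poly F ?B = (\<Sum>i<Suc H. coeff F i * ?B ^ i)"
    unfolding poly_altdef
  proof (rule sum.mono_neutral_left)
    have "degree F \<le> 2 * E" unfolding F_def E_def by (rule degree_code_mult_coeff_poly)
    also have "\<dots> \<le> E * d + E" using d by simp
    also have "\<dots> \<le> H" by (simp add: H_def)
    finally show "{..degree F} \<subseteq> {..<Suc H}" by auto
  qed (auto simp: coeff_eq_0)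
  also have "\<dots> + ?B' * (\<Sum>i<Suc H. ?B ^ i) = (\<Sum>i<Suc H. (coeff F i + ?B') * ?B ^ i)"
    by (simp only: sum_distrib_left distrib_right sum.distrib)
  also have "\<dots> = int (\<Sum>i<Suc H. nat (coeff F i + ?B') * nat ?B ^ i)"
  proof -
    have "0 \<le> coeff F i + ?B'" for i using coeff_F[of i] by linarith
    then show ?thesis using B by simp
  qed
  finally have K: "nat (value_code (int a) b g) = (\<Sum>i<Suc H. nat (coeff F i + ?B') * nat ?B ^ i)"
    by (simp only: nat_int)
  have "nat ?B = p ^ (\<beta> * p + r * d)" "nat ?B' = p ^ (\<beta> * p - 1 + r * d)"
    unfolding base_def subbase_def b(1) by (simp_all add: power_add power_mult nat_mult_distrib nat_power_eq)
  moreover have "nat (coeff F i + ?B') < nat ?B" for i using coeff_F[of i] B b(2) by linarith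
  ultimately have "no_carry p (nat (value_code (int a) b g)) ((nat ?B' - 1) * nat ?B ^ E) \<longleftrightarrow>
      nat ?B' dvd nat (coeff F E + ?B')"
    unfolding K by (intro no_carry_digit_dvd[OF p_ge_2]) (auto simp: H_def)
  also have "\<dots> \<longleftrightarrow> ?B' dvd coeff F E + ?B'"
    using coeff_F[of E] by (subst nat_dvd_iff) auto
  also have "\<dots> \<longleftrightarrow> coeff F E = 0"
    using coeff_F[of E] dvd_imp_le_int[of "coeff F E" ?B'] by (auto simp: dvd_add_left_iff)
  also have "coeff F E = fact d * mpoly_eval v P"
    unfolding F_def E_def by (rule coeff_code_mult_coeff_poly[OF P])
  finally show ?thesis by (simp add: v_def)
qed

lemma sum_positions:
  "(\<Sum>k\<in>positions. y k * (B::nat) ^ k) = (\<Sum>j\<in>{1..<n}. y (Suc d ^ j) * B ^ (Suc d ^ j))"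
proof -
  have "inj_on (\<lambda>j. Suc d ^ j) {1..<n}" using d by (auto simp: inj_on_def)
  then show ?thesis unfolding positions_def by (simp add: sum.reindex)
qed

lemma positions_subset: "positions \<subseteq> {..<E}"
  unfolding positions_def E_def using d by auto

lemma ex_positions_iff:
  "(\<exists>y. (\<forall>k\<in>positions. y k < b) \<and> g = (\<Sum>k\<in>positions. y k * (B::nat) ^ k)) \<longleftrightarrow>
   (\<exists>x. (\<forall>j\<in>{1..<n}. x j < (b::nat)) \<and> g = (\<Sum>j\<in>{1..<n}. x j * B ^ (Suc d ^ j)))"
proof
  assume "\<exists>y. (\<forall>k\<in>positions. y k < b) \<and> g = (\<Sum>k\<in>positions. y k * B ^ k)"
  then obtain y where "\<forall>k\<in>positions. y k < b" "g = (\<Sum>k\<in>positions. y k * B ^ k)" by blast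
  then show "\<exists>x. (\<forall>j\<in>{1..<n}. x j < b) \<and> g = (\<Sum>j\<in>{1..<n}. x j * B ^ (Suc d ^ j))"
    unfolding sum_positions by (intro exI[of _ "\<lambda>j. y (Suc d ^ j)"]) (auto simp: positions_def)
next
  assume "\<exists>x. (\<forall>j\<in>{1..<n}. x j < b) \<and> g = (\<Sum>j\<in>{1..<n}. x j * B ^ (Suc d ^ j))"
  then obtain x where x: "\<forall>j\<in>{1..<n}. x j < b" "g = (\<Sum>j\<in>{1..<n}. x j * B ^ (Suc d ^ j))" by blast
  have inj: "inj_on (\<lambda>j. Suc d ^ j) {1..<n}" using d by (auto simp: inj_on_def)
  define y where "y k = x (the_inv_into {1..<n} (\<lambda>j. Suc d ^ j) k)" for k
  have "y (Suc d ^ j) = x j" if "j \<in> {1..<n}" for j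
    unfolding y_def using the_inv_into_f_f[OF inj that] by simp
  then show "\<exists>y. (\<forall>k\<in>positions. y k < b) \<and> g = (\<Sum>k\<in>positions. y k * B ^ k)"
    unfolding sum_positions using x by (intro exI[of _ y]) (auto simp: positions_def)
qed

lemma code_less:
  assumes "\<And>j. j \<in> {1..<n} \<Longrightarrow> x j < (B::nat)"
  shows "(\<Sum>j\<in>{1..<n}. x j * B ^ (Suc d ^ j)) < B ^ E"
proof -
  obtain y where y: "\<forall>k\<in>positions. y k < B"
      "(\<Sum>j\<in>{1..<n}. x j * B ^ (Suc d ^ j)) = (\<Sum>k\<in>positions. y k * B ^ k)"
    using ex_positions_iff[of B "\<Sum>j\<in>{1..<n}. x j * B ^ (Suc d ^ j)" B] assms by blast
  note y(2)
  also have "(\<Sum>k\<in>positions. y k * B ^ k) = (\<Sum>k<E. (if k \<in> positions then y k else 0) * B ^ k)"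
    by (rule sum.mono_neutral_cong_left) (use positions_subset in auto)
  also have "\<dots> < B ^ E"
  proof (rule digits_less_power)
    have "B > 0" using assms[of 1] n by auto
    then show "(if k \<in> positions then y k else 0) < B" for k using y(1) by auto
  qed
  finally show ?thesis .
qed

text \<open>The condition splits at digit \<open>Suc E\<close>. The lower part forces
  \<open>g\<close> to be a code with digits below \<open>b\<close>, which is what makes
  \<open>value_code_mask\<close> applicable to the upper part.\<close>

lemma no_carry_S_T_iff:
  assumes b: "b = int (p ^ r)" "b \<ge> 2" and a: "int a < b" and g: "0 \<le> g" "g < 2 * base b ^ E"
  shows "no_carry p (nat (S (int a) b g)) (nat (T b)) \<longleftrightarrow>
    (\<exists>x. (\<forall>j\<in>{1..<n}. x j < p ^ r) \<and> g = (\<Sum>j\<in>{1..<n}. int (x j) * base b ^ (Suc d ^ j)) \<and>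
      mpoly_eval (\<lambda>i. if i = 0 then int a else int (x i)) P = 0)"
proof -
  define B where "B = nat (base b)"
  have B: "base b = int B" "B \<ge> 4" using base_ge[OF b(2)] by (auto simp: B_def)
  have "int (p ^ r) < int B" using base_ge(3)[OF b(2)] unfolding B(1) b(1)[symmetric] .
  then have rB: "p ^ r < B" by (simp only: of_nat_less_iff)
  have Bp: "B = p ^ (\<beta> * p + r * d)"
    unfolding base_def B_def b(1) by (simp add: power_add power_mult nat_mult_distrib nat_power_eq)
  have s: "subbase b \<ge> 2" using subbase_ge_b[OF b(2)] b(2) by linarith
  have K: "0 \<le> value_code (int a) b g" using value_code_bounds[OF b(2)] a g by simp
  have gB: "nat g < B ^ Suc E"
    using less_power_Suc_E[OF b(2) g(2)] g(1) unfolding B(1) by (simp add: nat_less_iff)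
  define M where "M = (\<Sum>j<Suc E. (if j \<in> positions then B - p ^ r else B - 1) * B ^ j)"
  have M: "mask b = int M"
    unfolding mask_def M_def B(1) unfolding b(1) of_nat_sum of_nat_mult of_nat_power[symmetric]
    using B rB by (intro sum.cong refl arg_cong2[of _ _ _ _ "(*)"]) (auto simp: of_nat_diff)
  have MB: "M < B ^ Suc E"
    using mask_bounds(2)[OF b(2)] unfolding M B(1) by (simp flip: of_nat_power of_nat_mult)
  have nS: "nat (S (int a) b g) = nat g + B ^ Suc E * nat (value_code (int a) b g)"
    unfolding S_def B(1) using g K by (simp add: nat_add_distrib nat_mult_distrib nat_power_eq)
  have "int (nat (subbase b) - 1) = subbase b - 1" using s by simp
  then have "T b = int (M + B ^ Suc E * ((nat (subbase b) - 1) * B ^ E))"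
    unfolding T_def B(1) M by simp
  then have nT: "nat (T b) = M + B ^ Suc E * ((nat (subbase b) - 1) * B ^ E)" by (simp only: nat_int)
  have BE: "B ^ Suc E = p ^ ((\<beta> * p + r * d) * Suc E)" unfolding Bp by (rule power_mult[symmetric])
  have sub: "positions \<subseteq> {..<Suc E}" using positions_subset by auto
  have "r \<le> \<beta> * p + r * d" using d by (simp add: trans_le_add2)
  note mask = no_carry_code_mask[OF p_ge_2 Bp refl this _ gB, of positions, folded M_def]
  have "no_carry p (nat (S (int a) b g)) (nat (T b)) \<longleftrightarrow> no_carry p (nat g) M \<and>
      no_carry p (nat (value_code (int a) b g)) ((nat (subbase b) - 1) * B ^ E)"
    unfolding nS nT using no_carry_append[OF p_ge_2, of "nat g" _ M] gB MB unfolding BE by blast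
  also have "no_carry p (nat g) M \<longleftrightarrow>
      (\<exists>x. (\<forall>j\<in>{1..<n}. x j < p ^ r) \<and> nat g = (\<Sum>j\<in>{1..<n}. x j * B ^ (Suc d ^ j)))"
    using mask[OF sub] unfolding ex_positions_iff .
  also have "\<dots> \<longleftrightarrow> (\<exists>x. (\<forall>j\<in>{1..<n}. x j < p ^ r) \<and>
      g = (\<Sum>j\<in>{1..<n}. int (x j) * base b ^ (Suc d ^ j)))"
  proof -
    have "nat g = u \<longleftrightarrow> g = int u" for u using g(1) by auto
    then show ?thesis unfolding B(1) by simp
  qed
  finally show ?thesis using value_code_mask[OF b _ a] unfolding B_def by blast
qed

section \<open>The polynomials \<open>X\<close> and \<open>Y\<close>\<close>

definition U :: "int \<Rightarrow> int \<Rightarrow> int" where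
  "U a f = int p ^ (2 * (\<beta> * p * Q)) * ((a * int p + 1) * f) * (\<Sum>i<2 * d * Q. b_val p a f ^ i)
     + (\<Sum>i<\<beta> * p * Q. (int p ^ 2) ^ i)"

text \<open>With \<open>N = p ^ (2 * s) * b ^ q\<close>, split \<open>N - 1\<close> into
  \<open>p ^ (2 * s) * (b ^ q - 1)\<close> and \<open>p ^ (2 * s) - 1\<close>. Both are geometric
  sums times a multiple of \<open>p ^ 2 - 1\<close>, as \<open>b - 1\<close> is one;
  \<open>U\<close> collects the quotients.\<close>

lemma base_power_minus_1:
  "base (b_val p a f) ^ (2 * Q) - 1 = ((int p)\<^sup>2 - 1) * U a f"
proof -
  let ?b = "b_val p a f" and ?s = "\<beta> * p * Q" and ?q = "2 * d * Q"
  have N: "base ?b ^ (2 * Q) = int p ^ (2 * ?s) * ?b ^ ?q"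
    by (simp add: base_def power_mult_distrib flip: power_mult) (simp add: mult_ac)
  define h where "h = (a * int p + 1) * f"
  have "?b - 1 = ((int p)\<^sup>2 - 1) * h"
    by (simp add: b_val_def h_def mult.assoc)
  then have bq: "?b ^ ?q - 1 = ((int p)\<^sup>2 - 1) * h * (\<Sum>i<?q. ?b ^ i)"
    unfolding power_diff_1_eq[of ?b] by (simp only:)
  have ps: "int p ^ (2 * ?s) - 1 = ((int p)\<^sup>2 - 1) * (\<Sum>i<?s. (int p ^ 2) ^ i)"
    unfolding power_mult[of _ 2 ?s] power_diff_1_eq[of "(int p)\<^sup>2"] ..
  have "base ?b ^ (2 * Q) - 1 = int p ^ (2 * ?s) * (?b ^ ?q - 1) + (int p ^ (2 * ?s) - 1)"
    unfolding N by (simp only: right_diff_distrib mult_1_right)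
  then show ?thesis unfolding bq ps U_def h_def[symmetric] by (simp only: distrib_left mult_ac)
qed

text \<open>\<open>(p + 1) * U a f\<close> is the polynomial form of
  \<open>(N - 1) / (p - 1)\<close>, so \<open>X\<close> is the argument that
  \<open>square_dvd_binomial_iff_no_carry\<close> asks for.\<close>

definition X :: "int \<Rightarrow> int \<Rightarrow> int \<Rightarrow> int" where
  "X a f g = (let b = b_val p a f; N = base b ^ (2 * Q) in
     (int p + 1) * U a f * ((S a b g + T b + 1) * N + T b + 1))"

definition Y :: "int \<Rightarrow> int \<Rightarrow> int \<Rightarrow> int" where
  "Y a f g = (base (b_val p a f) ^ (2 * Q)) ^ 2"

lemma polyfun3_X: "polyfun3 X"
  unfolding X_def Let_def U_def S_def T_def value_code_def mask_def base_def subbase_def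
  by (intro polyfun3_add polyfun3_mult polyfun3_diff polyfun3_sum polyfun3_power polyfun3_poly
      polyfun3_if polyfun3_b_val polyfun3_const polyfun3_a polyfun3_f polyfun3_g)

lemma polyfun3_Y: "polyfun3 Y"
  unfolding Y_def base_def
  by (intro polyfun3_mult polyfun3_power polyfun3_b_val polyfun3_const)

text \<open>Fixes the two exponents of the theorem: codes have at most \<open>E\<close> digits, and
  the bound for them is to be \<open>base b ^ E\<close>.\<close>

lemma C_val_eq: "C_val (\<beta> * E) (d * E) p a f = base (b_val p a f) ^ E"
  by (simp add: C_val_def base_def power_mult_distrib flip: power_mult) (simp add: mult_ac)

lemma U_pos:
  fixes a :: nat
  assumes "f > 0" "b_val p (int a) f \<ge> 2"
  shows "U (int a) f \<ge> 1"
proof -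
  have "(\<Sum>i<2 * d * Q. b_val p (int a) f ^ i) > 0"
    using assms d by (intro sum_pos) (auto simp: Q_def lessThan_empty_iff)
  moreover have "(\<Sum>i<\<beta> * p * Q. (int p ^ 2) ^ i) \<ge> 0" by (intro sum_nonneg) auto
  moreover have "int p ^ (2 * (\<beta> * p * Q)) * ((int a * int p + 1) * f) > 0"
    using assms p_ge_2 by (intro mult_pos_pos zero_less_power add_nonneg_pos) auto
  ultimately show ?thesis unfolding U_def
    by (smt (verit) mult_pos_pos)
qed

text \<open>\<open>U\<close> is at least 1 and the last factor of \<open>X\<close> is at least
  \<open>N \<ge> b\<close>, while \<open>p + 1 \<ge> 3\<close>. For \<open>Y = N ^ 2\<close> it
  suffices that \<open>N \<ge> base b ^ 2 \<ge> p ^ (2 * p)\<close>.\<close>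

lemma X_Y_bounds:
  fixes a :: nat
  assumes f: "f \<noteq> 0" and b: "b_val p (int a) f \<in> squares"
    and g: "0 \<le> g" "g < 2 * base (b_val p (int a) f) ^ E"
  shows "int p + 1 dvd X (int a) f g" "X (int a) f g \<ge> 3 * b_val p (int a) f"
    "Y (int a) f g \<ge> max (b_val p (int a) f) (int p ^ (4 * p))"
proof -
  define b where "b = b_val p (int a) f"
  have bf: "f > 0" "int a < b" "b \<ge> 2" using b_val_bounds[OF p_ge_2 f b] by (auto simp: b_def)
  define N where "N = base b ^ (2 * Q)"
  define R where "R = (S (int a) b g + T b + 1) * N + T b + 1"
  have X: "X (int a) f g = (int p + 1) * (U (int a) f * R)"
    by (simp add: X_def Let_def R_def N_def b_def mult.assoc)
  then show "int p + 1 dvd X (int a) f g" by simp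
  note ST = S_T_bounds[OF bf(3) _ bf(2) g[folded b_def]]
  have B: "base b > b" "base b \<ge> 4" using base_ge[OF bf(3)] by auto
  have N2: "base b ^ 2 \<le> N" unfolding N_def using B by (intro power_increasing) (auto simp: Q_def)
  have "base b ^ 1 \<le> base b ^ 2" using B by (intro power_increasing) auto
  then have Nb: "b \<le> N" "N \<ge> 1" using N2 B bf by auto
  have "1 * N \<le> (S (int a) b g + T b + 1) * N" using ST Nb by (intro mult_right_mono) auto
  then have R: "b \<le> R" using ST Nb unfolding R_def by linarith
  have "U (int a) f \<ge> 1" using U_pos[of f a] bf unfolding b_def by simp
  then have "1 * b \<le> U (int a) f * R" using bf R by (intro mult_mono) auto
  then have "3 * b \<le> (int p + 1) * (U (int a) f * R)"
    using p_ge_2 bf by (intro mult_mono) auto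
  then show "X (int a) f g \<ge> 3 * b_val p (int a) f" unfolding X b_def .
  have "int p ^ p \<le> int p ^ (\<beta> * p)" using \<beta> p_ge_2 by (intro power_increasing) auto
  also have "\<dots> * 1 \<le> base b" unfolding base_def using bf p_ge_2
    by (intro mult_left_mono one_le_power) auto
  finally have "(int p ^ p) ^ 2 \<le> base b ^ 2" by (intro power_mono) auto
  then have "((int p ^ p) ^ 2) ^ 2 \<le> N ^ 2" using N2 by (intro power_mono) auto
  then have "int p ^ (4 * p) \<le> N ^ 2" by (simp add: mult_ac flip: power_mult)
  moreover have "N ^ 1 \<le> N ^ 2" using Nb by (intro power_increasing) auto
  ultimately show "Y (int a) f g \<ge> max (b_val p (int a) f) (int p ^ (4 * p))"
    using Nb unfolding Y_def b_def[symmetric] N_def[symmetric] by auto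
qed

text \<open>Since \<open>b\<close> is a power of \<open>p\<close>, so is \<open>N\<close>.
  Multiplying \<open>X\<close> by \<open>p - 1\<close> completes \<open>U\<close> to
  \<open>N - 1\<close>, and Kummer's criterion passes to the condition on \<open>S\<close> and
  \<open>T\<close>.\<close>

lemma dvd_binom_iff:
  fixes a :: nat
  assumes f: "f \<noteq> 0" and b: "b_val p (int a) f \<in> squares" and r: "b_val p (int a) f = int (p ^ r)"
    and g: "0 \<le> g" "g < 2 * base (b_val p (int a) f) ^ E"
  shows "dvd_binom p (Y (int a) f g) (X (int a) f g) \<longleftrightarrow>
    (\<exists>x. (\<forall>j\<in>{1..<n}. x j < p ^ r) \<and>
      g = (\<Sum>j\<in>{1..<n}. int (x j) * base (b_val p (int a) f) ^ (Suc d ^ j)) \<and>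
      mpoly_eval (\<lambda>i. if i = 0 then int a else int (x i)) P = 0)"
proof -
  define b where "b = b_val p (int a) f"
  have bf: "f > 0" "int a < b" "b \<ge> 2" using b_val_bounds[OF p_ge_2 f b] by (auto simp: b_def)
  define N s t where "N = nat (base b ^ (2 * Q))" and "s = nat (S (int a) b g)" and "t = nat (T b)"
  note ST = S_T_bounds[OF bf(3) _ bf(2) g[folded b_def]]
  have B: "base b \<ge> 4" using base_ge[OF bf(3)] by auto
  have N: "base b ^ (2 * Q) = int N" "N \<ge> 1" using B unfolding N_def by (auto simp: Suc_le_eq)
  have st: "S (int a) b g = int s" "T b = int t" "s < N" "t < N"
    using ST N unfolding s_def t_def by auto
  have "nat (base b) = p ^ (\<beta> * p + r * d)"
    unfolding base_def b_def r by (simp add: power_add power_mult nat_mult_distrib nat_power_eq)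
  then have Np: "N = p ^ ((\<beta> * p + r * d) * (2 * Q))"
    unfolding N_def using B by (simp add: nat_power_eq power_mult)
  define x where "x = nat (X (int a) f g)"
  have X0: "X (int a) f g = int x" unfolding x_def using X_Y_bounds(2)[OF f b g] bf b_def by simp
  have "int (p - 1) * X (int a) f g = ((int p)\<^sup>2 - 1) * U (int a) f * ((int s + int t + 1) * int N + int t + 1)"
    using p_ge_2 unfolding X_def Let_def b_def[symmetric] N(1) st
    by (simp add: of_nat_diff power2_eq_square) (simp add: algebra_simps)
  also have "((int p)\<^sup>2 - 1) * U (int a) f = int (N - 1)"
    using base_power_minus_1[of "int a" f] N unfolding b_def by (simp add: of_nat_diff)
  finally have "int ((p - 1) * x) = int ((N - 1) * ((s + t + 1) * N + t + 1))"
    unfolding X0 of_nat_mult of_nat_add of_nat_1 by (simp only: mult_ac)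
  then have x: "(p - 1) * x = (N - 1) * ((s + t + 1) * N + t + 1)" by (simp only: of_nat_eq_iff)
  have "dvd_binom p (Y (int a) f g) (X (int a) f g) \<longleftrightarrow> int (N ^ 2) dvd int (p * x choose x)"
    unfolding dvd_binom_def Y_def b_def[symmetric] N(1) X0 by (simp add: nat_mult_distrib)
  also have "\<dots> \<longleftrightarrow> no_carry p s t"
    unfolding int_dvd_int_iff using square_dvd_binomial_iff_no_carry[OF prime_p Np st(3,4) x] .
  finally show ?thesis
    using no_carry_S_T_iff[OF r[folded b_def] bf(3,2) g[folded b_def]] unfolding s_def t_def b_def by simp
qed

text \<open>The unknown with index \<open>n - 1\<close> does not occur in \<open>P\<close>; setting it to \<open>1\<close> ensures
  \<open>g \<ge> b\<close>.\<close>

lemma ex_f_g: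
  fixes a :: nat and x :: "nat \<Rightarrow> nat"
  assumes "mpoly_eval (\<lambda>i. if i = 0 then int a else int (x i)) P = 0"
    and free: "n - 1 \<notin> mpoly_vars P"
  shows "\<exists>f g. f \<ge> Z \<and> g \<in> {b_val p (int a) f ..< base (b_val p (int a) f) ^ E} \<and>
    b_val p (int a) f \<in> squares \<and> b_val p (int a) f \<in> powers_of p \<and>
    dvd_binom p (Y (int a) f g) (X (int a) f g)"
proof -
  define y where "y = x(n - 1 := 1)"
  have y: "mpoly_eval (\<lambda>i. if i = 0 then int a else int (y i)) P = 0"
    unfolding assms(1)[symmetric] by (rule mpoly_eval_cong) (use free in \<open>auto simp: y_def\<close>)
  \<comment> \<open>Because \<open>b > f\<close>, requiring \<open>f\<close> to be at least the sum
    of the unknowns makes each of them a digit below \<open>b\<close>; the 1 keeps \<open>f\<close>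
    nonzero.\<close>
  obtain f where f: "f \<ge> max (max Z 1) (\<Sum>j\<in>{1..<n}. int (y j))"
    and sq: "b_val p (int a) f \<in> squares" and pw: "b_val p (int a) f \<in> powers_of p"
    using ex_b_val_square_power[OF prime_p] by blast
  from pw obtain r where r: "b_val p (int a) f = int (p ^ r)" by (auto simp: powers_of_def)
  have f0: "f \<noteq> 0" using f by auto
  define b where "b = b_val p (int a) f"
  have bf: "f > 0" "int a < b" "b \<ge> 2" "b > f"
    using b_val_bounds[OF p_ge_2 f0 sq] f by (auto simp: b_def)
  have B: "base b > b" "base b \<ge> 4" using base_ge[OF bf(3)] by auto
  have yb: "y j < p ^ r" if "j \<in> {1..<n}" for j
  proof -
    have "int (y j) \<le> (\<Sum>j\<in>{1..<n}. int (y j))" using that by (intro member_le_sum) auto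
    with f bf(4) have "int (y j) < int (p ^ r)" unfolding b_def r by linarith
    then show ?thesis by (simp only: of_nat_less_iff)
  qed
  define g where "g = (\<Sum>j\<in>{1..<n}. int (y j) * base b ^ (Suc d ^ j))"
  have "int (y (n - 1)) * base b ^ (Suc d ^ (n - 1)) \<le> g"
    unfolding g_def using n B by (intro member_le_sum) auto
  moreover have "base b ^ 1 \<le> base b ^ (Suc d ^ (n - 1))" using B by (intro power_increasing) auto
  ultimately have gb: "b \<le> g" using B by (simp add: y_def)
  have "g = int (\<Sum>j\<in>{1..<n}. y j * nat (base b) ^ (Suc d ^ j))" using B by (simp add: g_def)
  also have "\<dots> < int (nat (base b) ^ E)"
  proof -
    have "int (p ^ r) < base b" using B unfolding b_def r by simp
    then have "p ^ r < nat (base b)" by linarith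
    then show ?thesis unfolding of_nat_less_iff using yb by (intro code_less) (meson less_trans)
  qed
  also have "\<dots> = base b ^ E" using B by simp
  finally have gE: "g < base b ^ E" .
  then have g2: "0 \<le> g" "g < 2 * base b ^ E" using gb bf by auto
  have "dvd_binom p (Y (int a) f g) (X (int a) f g)"
    unfolding dvd_binom_iff[OF f0 sq r g2[unfolded b_def]] using y yb g_def b_def by blast
  then show ?thesis using f sq pw gb gE unfolding b_def by auto
qed

lemma ex_zero:
  fixes a :: nat
  assumes f: "f \<noteq> 0" and sq: "b_val p (int a) f \<in> squares" and pw: "b_val p (int a) f \<in> powers_of p"
    and g: "g \<in> {0 ..< 2 * base (b_val p (int a) f) ^ E}"
    and dvd: "dvd_binom p (Y (int a) f g) (X (int a) f g)"
  shows "\<exists>x. mpoly_eval (\<lambda>i. if i = 0 then int a else int (x i)) P = 0"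
proof -
  from pw obtain r where "b_val p (int a) f = int (p ^ r)" by (auto simp: powers_of_def)
  from dvd_binom_iff[OF f sq this] g dvd show ?thesis by auto
qed

end

section \<open>Choice of the parameters and conclusion\<close>

theorem theorem3p1:
  fixes A :: "nat set"
  assumes "diophantine A"
  shows "\<exists>(\<alpha>1::nat) (\<alpha>2::nat). \<alpha>1 > 0 \<and> \<alpha>2 > 0 \<and>
    (\<forall>p::nat. prime p \<longrightarrow>
      (\<exists>X Y. poly3 X \<and> poly3 Y \<and>
        (\<forall>a::nat.
          (a \<in> A \<longrightarrow>
            (\<forall>Z::int. Z > 0 \<longrightarrow>
              (\<exists>(f::int) (g::int). f \<ge> Z \<and>
                 g \<in> {b_val p (int a) f ..< C_val \<alpha>1 \<alpha>2 p (int a) f} \<and>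
                 b_val p (int a) f \<in> squares \<and>
                 b_val p (int a) f \<in> powers_of p \<and>
                 dvd_binom p (eval3 Y (int a) f g) (eval3 X (int a) f g)))) \<and>
          ((\<exists>(f::int) (g::int). f \<noteq> 0 \<and>
                 g \<in> {0 ..< 2 * C_val \<alpha>1 \<alpha>2 p (int a) f} \<and>
                 b_val p (int a) f \<in> squares \<and>
                 b_val p (int a) f \<in> powers_of p \<and>
                 dvd_binom p (eval3 Y (int a) f g) (eval3 X (int a) f g)) \<longrightarrow> a \<in> A) \<and>
          (\<forall>(f::int) (g::int). f \<noteq> 0 \<and> b_val p (int a) f \<in> squares \<and>
                 0 \<le> g \<and> g < 2 * C_val \<alpha>1 \<alpha>2 p (int a) f \<longrightarrow>
                 int p + 1 dvd eval3 X (int a) f g \<and>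
                 eval3 X (int a) f g \<ge> 3 * b_val p (int a) f \<and>
                 eval3 Y (int a) f g \<ge> max (b_val p (int a) f) (int p ^ (4 * p))))))"
proof -
  from assms obtain n0 P where vars: "mpoly_vars P \<subseteq> {0..n0}" and
    A: "\<And>a. a \<in> A \<longleftrightarrow>
       (\<exists>x :: nat \<Rightarrow> nat. mpoly_eval (\<lambda>i. if i = 0 then int a else int (x i)) P = 0)"
    unfolding diophantine_def by blast
  \<comment> \<open>One more index than \<open>{0..n0}\<close> needs, so that
    \<open>n - 1 = n0 + 1\<close> is a spare unknown absent from \<open>P\<close>.\<close>
  define n where "n = n0 + 2"
  \<comment> \<open>The sum of all exponents bounds every total degree; the 1 keeps \<open>d\<close>
    positive even for constant \<open>P\<close>.\<close>
  define d where "d = 1 + (\<Sum>m\<in>Poly_Mapping.keys P. \<Sum>j<n. Poly_Mapping.lookup m j)"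
  \<comment> \<open>Any number above the bound will do, because
    \<open>\<beta> < 2 ^ \<beta>\<close>.\<close>
  define \<beta> where "\<beta> = nat (int (n + 1) ^ d * weight_bound P d n) + 1"
  have bounded: "bounded_mpoly P d n"
    unfolding bounded_mpoly_def
  proof
    fix m assume m: "m \<in> Poly_Mapping.keys P"
    have "Poly_Mapping.keys m \<subseteq> {..<n}" using vars m unfolding mpoly_vars_def n_def by fastforce
    moreover have "(\<Sum>j<n. Poly_Mapping.lookup m j) \<le> d"
      using member_le_sum[of m "Poly_Mapping.keys P" "\<lambda>m. \<Sum>j<n. Poly_Mapping.lookup m j"] m
      unfolding d_def by simp
    ultimately show "Poly_Mapping.keys m \<subseteq> {..<n} \<and> (\<Sum>j<n. Poly_Mapping.lookup m j) \<le> d" ..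
  qed
  have \<beta>: "int (n + 1) ^ d * weight_bound P d n < 2 ^ \<beta>"
  proof -
    have "int (n + 1) ^ d * weight_bound P d n < int \<beta>" unfolding \<beta>_def by linarith
    also have "int \<beta> < int (2 ^ \<beta>)" by (simp only: of_nat_less_iff less_exp)
    finally show ?thesis by simp
  qed
  have nd: "n \<ge> 2" "d \<ge> 1" "\<beta> \<ge> 1" by (simp_all add: n_def d_def \<beta>_def)
  show ?thesis
  proof (rule exI[of _ "\<beta> * Suc d ^ n"], rule exI[of _ "d * Suc d ^ n"], intro conjI allI impI)
    show "\<beta> * Suc d ^ n > 0" "d * Suc d ^ n > 0" using nd by simp_all
    fix p :: nat assume p: "prime p"
    interpret coding P n d \<beta> p
      using bounded \<beta> p nd by unfold_locales
    note C = C_val_eq[unfolded E_def]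
    obtain QX QY where Q: "poly3 QX" "poly3 QY"
      "\<And>a f g. eval3 QX a f g = X a f g" "\<And>a f g. eval3 QY a f g = Y a f g"
      using polyfun3_X polyfun3_Y unfolding polyfun3_def by blast
    have free: "n - 1 \<notin> mpoly_vars P" using vars by (auto simp: n_def)
    note F = ex_f_g[OF _ free, unfolded E_def] and Z = ex_zero[unfolded E_def]
      and XY = X_Y_bounds[unfolded E_def]
    show "\<exists>X Y. poly3 X \<and> poly3 Y \<and> (\<forall>a::nat.
          (a \<in> A \<longrightarrow>
            (\<forall>Z::int. Z > 0 \<longrightarrow>
              (\<exists>(f::int) (g::int). f \<ge> Z \<and>
                 g \<in> {b_val p (int a) f ..< C_val (\<beta> * Suc d ^ n) (d * Suc d ^ n) p (int a) f} \<and>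
                 b_val p (int a) f \<in> squares \<and>
                 b_val p (int a) f \<in> powers_of p \<and>
                 dvd_binom p (eval3 Y (int a) f g) (eval3 X (int a) f g)))) \<and>
          ((\<exists>(f::int) (g::int). f \<noteq> 0 \<and>
                 g \<in> {0 ..< 2 * C_val (\<beta> * Suc d ^ n) (d * Suc d ^ n) p (int a) f} \<and>
                 b_val p (int a) f \<in> squares \<and>
                 b_val p (int a) f \<in> powers_of p \<and>
                 dvd_binom p (eval3 Y (int a) f g) (eval3 X (int a) f g)) \<longrightarrow> a \<in> A) \<and>
          (\<forall>(f::int) (g::int). f \<noteq> 0 \<and> b_val p (int a) f \<in> squares \<and>
                 0 \<le> g \<and> g < 2 * C_val (\<beta> * Suc d ^ n) (d * Suc d ^ n) p (int a) f \<longrightarrow>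
                 int p + 1 dvd eval3 X (int a) f g \<and>
                 eval3 X (int a) f g \<ge> 3 * b_val p (int a) f \<and>
                 eval3 Y (int a) f g \<ge> max (b_val p (int a) f) (int p ^ (4 * p))))"
    proof (rule exI[of _ QX], rule exI[of _ QY], intro conjI allI impI, unfold Q(3,4) C, goal_cases)
      case 1
      show ?case by (rule Q(1))
    next
      case 2
      show ?case by (rule Q(2))
    next
      case (3 a Z)
      then obtain x where "mpoly_eval (\<lambda>i. if i = 0 then int a else int (x i)) P = 0"
        unfolding A by blast
      then show ?case by (rule F)
    next
      case (4 a)
      then show ?case unfolding A by (elim exE conjE) (rule Z)
    next
      case (5 a f g)
      then show ?case by (elim conjE) (rule XY)
    next
      case (6 a f g)
      then show ?case by (elim conjE) (rule XY)
    next
      case (7 a f g)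
      then show ?case by (elim conjE) (rule XY)
    qed
  qed
qed

end
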